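(* Let $T>0$, let $q\in L^\infty(0,1)$ (real-valued), $a\in L^\infty[0,T]$ with $a(t)\ge a_0>0$ on $[0,T]$, and $u_0\in L^2(0,1)$ with $u_0''\in L^2(0,1)$. Let $u\in C([0,T];L^2(0,1))$ be the unique classical solution of $$\partial_tu+a(t)\big(-\partial_x^2u+q(x)u\big)=0 \text{ on }[0,T]\times(0,1),\quad u(0,x)=u_0(x),\quad u(t,0)=0=u(t,1).$$ Then for any families $q_\varepsilon$, $a_\varepsilon$, $u_{0,\varepsilon}$ with $\|u_0-u_{0,\varepsilon}\|_{L^2}\to0$, $\|q-q_\varepsilon\|_{L^\infty}\to0$ and $\|a-a_\varepsilon\|_{L^\infty[0,T]}\to0$ as $\varepsilon\to0$, any representative $(u_\varepsilon)$ of the very weak solution, i.e. $u_\varepsilon$ solving $\partial_tu_\varepsilon+a_\varepsilon(t)(-\partial_x^2u_\varepsilon+q_\varepsilon(x)u_\varepsilon)=0$, $u_\varepsilon(0,\cdot)=u_{0,\varepsilon}$, $u_\varepsilon(t,0)=0=u_\varepsilon(t,1)$, satisfies $$\sup_{0\le t\le T}\|u(t,\cdot)-u_\varepsilon(t,\cdot)\|_{L^2}\to0\quad\text{as }\varepsilon\to0.$$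
   Context: The classical solution is the one given by the well-posedness theory for $q\in L^\infty$, $a\in L^\infty$, $a\ge a_0>0$: $u(t,x)=\sum_n B_ne^{-\lambda_n\int_0^ta(\tau)d\tau}\phi_n(x)$ with $\lambda_n,\phi_n$ the Dirichlet eigenvalues and orthonormal eigenfunctions of $-\frac{d^2}{dx^2}+q$ on $(0,1)$ and $B_n=\int_0^1u_0\phi_n$. *)

theory Defs
  imports "HOL-Analysis.Analysis" "HOL-Probability.Essential_Supremum"
begin

definition L2 :: "(real \<Rightarrow> real) \<Rightarrow> bool" where
  "L2 f \<longleftrightarrow> f \<in> borel_measurable (lebesgue_on {0..1}) \<and> (\<lambda>x. (f x)^2) integrable_on {0..1}"

definition L2norm :: "(real \<Rightarrow> real) \<Rightarrow> real" where
  "L2norm f = sqrt (integral {0..1} (\<lambda>x. (f x)^2))"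

definition Linf :: "real set \<Rightarrow> (real \<Rightarrow> real) \<Rightarrow> bool" where
  "Linf S f \<longleftrightarrow> f \<in> borel_measurable (lebesgue_on S) \<and>
     (\<exists>C. AE x in lebesgue_on S. \<bar>f x\<bar> \<le> C)"

definition Linf_norm :: "real set \<Rightarrow> (real \<Rightarrow> real) \<Rightarrow> ereal" where
  "Linf_norm S f = esssup (lebesgue_on S) (\<lambda>x. ereal \<bar>f x\<bar>)"

text \<open>Functions u0 in H^2(0,1), i.e. u0 in L2 with distributional u0'' in L2:
  a.e. equal to c + d x + double primitive of an L2 function g.\<close>
definition H2 :: "(real \<Rightarrow> real) \<Rightarrow> bool" where
  "H2 u0 \<longleftrightarrow> L2 u0 \<and> (\<exists>g c d. L2 g \<and>
      (AE x in lebesgue_on {0..1}. u0 x = c + d * x + integral {0..x} (\<lambda>s. integral {0..s} g)))"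

text \<open>Dirichlet eigenpair of -d^2/dx^2 + q on (0,1) (Caratheodory sense:
  phi is C^1 on [0,1] with phi' absolutely continuous and phi'' = (q - mu) phi a.e.).\<close>
definition dir_eigenpair :: "(real \<Rightarrow> real) \<Rightarrow> real \<Rightarrow> (real \<Rightarrow> real) \<Rightarrow> bool" where
  "dir_eigenpair q \<mu> \<phi> \<longleftrightarrow> \<phi> 0 = 0 \<and> \<phi> 1 = 0 \<and> (\<exists>x\<in>{0..1}. \<phi> x \<noteq> 0) \<and>
     (\<exists>\<psi>. (\<forall>x\<in>{0..1}. (\<phi> has_real_derivative \<psi> x) (at x within {0..1})) \<and>
          (\<forall>x\<in>{0..1}. \<psi> x = \<psi> 0 + integral {0..x} (\<lambda>s. (q s - \<mu>) * \<phi> s)))"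

definition dir_spectrum :: "(real \<Rightarrow> real) \<Rightarrow> (nat \<Rightarrow> real) \<Rightarrow> (nat \<Rightarrow> real \<Rightarrow> real) \<Rightarrow> bool" where
  "dir_spectrum q lam \<phi> \<longleftrightarrow> strict_mono lam \<and>
     (\<forall>n. dir_eigenpair q (lam n) (\<phi> n) \<and> integral {0..1} (\<lambda>x. (\<phi> n x)^2) = 1) \<and>
     (\<forall>\<mu> \<psi>. dir_eigenpair q \<mu> \<psi> \<longrightarrow> (\<exists>n. \<mu> = lam n))"

text \<open>u is the (eigenfunction-expansion) solution on [0,T] of
  u_t + a(t)(-u_xx + q u) = 0, u(0) = u0, Dirichlet boundary conditions:
  for each t, u t is the L2-limit of the partial sums of
  sum_n B_n exp(-lam_n int_0^t a) phi_n, with B_n = int u0 phi_n.\<close>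
definition eig_solution ::
  "real \<Rightarrow> (real \<Rightarrow> real) \<Rightarrow> (real \<Rightarrow> real) \<Rightarrow> (real \<Rightarrow> real) \<Rightarrow> (real \<Rightarrow> real \<Rightarrow> real) \<Rightarrow> bool" where
  "eig_solution T q a u0 u \<longleftrightarrow> (\<exists>lam \<phi>. dir_spectrum q lam \<phi> \<and>
     (\<forall>t\<in>{0..T}. L2 (u t) \<and>
        (\<lambda>N. L2norm (\<lambda>x. u t x - (\<Sum>n<N. integral {0..1} (\<lambda>y. u0 y * \<phi> n y)
               * exp (- lam n * integral {0..t} a) * \<phi> n x))) \<longlonglongrightarrow> 0))"

end

theory Submission
  imports Defs "HOL-Complex_Analysis.Great_Picard" "HOL-Real_Asymp.Real_Asymp"
begin

text \<open>
  Let \<open>L\<close> and \<open>L'\<close> be the Dirichlet operators with potentials \<open>q\<close> and \<open>q'\<close>, with eigenpairs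
  \<open>(\<lambda>\<^sub>n, \<phi>\<^sub>n)\<close> and \<open>(\<lambda>'\<^sub>k, \<phi>'\<^sub>k)\<close>. Each \<open>\<phi>\<^sub>n\<close> is an approximate eigenfunction of \<open>L'\<close>:
  Green's identity gives \<open>(\<lambda>'\<^sub>k - \<lambda>\<^sub>n) \<langle>\<phi>\<^sub>n, \<phi>'\<^sub>k\<rangle> = \<langle>(q' - q) \<phi>\<^sub>n, \<phi>'\<^sub>k\<rangle>\<close>, and since
  \<open>s \<mapsto> exp (- s A)\<close> is Lipschitz above the common lower bound of the spectra, Bessel's inequality
  shows that the evolution generated by \<open>L'\<close> maps \<open>\<phi>\<^sub>n\<close> to \<open>exp (- \<lambda>\<^sub>n A) \<phi>\<^sub>n\<close> up to an error of order
  the sup norm of \<open>q' - q\<close>. Both evolutions are bounded uniformly on \<open>[0,T]\<close>, so it suffices to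
  approximate the initial value by finitely many \<open>\<phi>\<^sub>n\<close>.

  This needs the completeness of both eigenfunction systems. A shifted operator has an inverse that is
  symmetric, and compact by the theorem of Arzela and Ascoli. On the orthogonal complement of
  all eigenfunctions this inverse vanishes, since otherwise it would have an eigenvector there, and
  the eigenvalues of \<open>L\<close> are simple and all occur among the \<open>\<lambda>\<^sub>n\<close>.
\<close>

section \<open>Square-integrable functions\<close>

text \<open>The eigenvalues of the two operators are never matched with each other, so no eigenvalue
  perturbation theory or asymptotics enters. The finite sums run over the unperturbed
  \<open>\<phi>\<^sub>n\<close>: their number, eigenvalues and coefficients are fixed before
  \<epsilon> is made small. The perturbed system changes with \<epsilon> and enters only through a
  lower bound of its spectrum, Bessel's inequality and the convergence of the expansions of the
  \<open>\<phi>\<^sub>n\<close>. These satisfy the Dirichlet conditions, hence lie in the range of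
  the perturbed resolvent, where compactness gives that convergence. The initial value may have
  nonzero boundary values and is only a limit of elements of the unperturbed range. The space built
  below is a bare inner product space: limits in it come from Arzela-Ascoli, from explicit
  approximations or from the given solutions. Essentially bounded coefficients are replaced by
  everywhere bounded ones, which is harmless because eigenpairs and exponents see them only through
  integrals.\<close>

lemma negligible_of_AE_lebesgue_on:
  assumes "AE x in lebesgue_on S. P x" "S \<in> sets lebesgue"
  obtains N where "negligible N" "\<And>x. x \<in> S - N \<Longrightarrow> P x"
proof -
  have "AE x in lebesgue. x \<in> S \<longrightarrow> P x"
    using assms by (simp add: AE_restrict_space_iff)
  then obtain N where "negligible N" "{x. \<not> (x \<in> S \<longrightarrow> P x)} \<subseteq> N"
    unfolding eventually_ae_filter_negligible by auto
  then show thesis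
    by (intro that[of N]) auto
qed

lemma integral_cong_AE_lebesgue_on:
  assumes "AE x in lebesgue_on S. f x = g x" "S \<in> sets lebesgue" "X \<subseteq> S"
  shows "integral X f = integral X g"
proof -
  obtain N where "negligible N" "\<And>x. x \<in> S - N \<Longrightarrow> f x = g x"
    using negligible_of_AE_lebesgue_on[OF assms(1,2)] by blast
  then show ?thesis
    using assms(3) by (intro integral_spike[of N]) auto
qed

lemma integrable_cong_AE_lebesgue_on:
  assumes "AE x in lebesgue_on S. f x = g x" "S \<in> sets lebesgue" "X \<subseteq> S" "f integrable_on X"
  shows "g integrable_on X"
proof -
  obtain N where "negligible N" "\<And>x. x \<in> S - N \<Longrightarrow> f x = g x"
    using negligible_of_AE_lebesgue_on[OF assms(1,2)] by blast
  then show ?thesis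
    using assms(3) by (intro integrable_spike[OF assms(4), of N]) auto
qed

lemma L2_measurable: "L2 f \<Longrightarrow> f \<in> borel_measurable (lebesgue_on {0..1})"
  by (simp add: L2_def)

lemma L2_square_integrable: "L2 f \<Longrightarrow> (\<lambda>x. (f x)\<^sup>2) integrable_on {0..1}"
  by (simp add: L2_def)

lemma L2_mult_absolutely_integrable:
  assumes "L2 f" "L2 g"
  shows "(\<lambda>x. f x * g x) absolutely_integrable_on {0..1}"
proof (rule measurable_bounded_by_integrable_imp_absolutely_integrable)
  show "(\<lambda>x. f x * g x) \<in> borel_measurable (lebesgue_on {0..1})"
    using assms by (auto simp: L2_def)
  show "(\<lambda>x. (f x)\<^sup>2 + (g x)\<^sup>2) integrable_on {0..1}"
    using assms by (auto simp: L2_def intro: integrable_add)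
  show "norm (f x * g x) \<le> (f x)\<^sup>2 + (g x)\<^sup>2" for x
    using sum_squares_bound[of "\<bar>f x\<bar>" "\<bar>g x\<bar>"] mult_nonneg_nonneg[OF abs_ge_zero[of "f x"] abs_ge_zero[of "g x"]]
    unfolding real_norm_def abs_mult power2_abs by linarith
qed auto

lemma L2_mult_integrable: "L2 f \<Longrightarrow> L2 g \<Longrightarrow> (\<lambda>x. f x * g x) integrable_on {0..1}"
  using L2_mult_absolutely_integrable absolutely_integrable_on_def by blast

lemma L2_continuous: "continuous_on {0..1} f \<Longrightarrow> L2 f"
  unfolding L2_def
  by (intro conjI continuous_imp_measurable_on_sets_lebesgue integrable_continuous_interval continuous_on_power) auto

lemma L2_absolutely_integrable: "L2 f \<Longrightarrow> f absolutely_integrable_on {0..1}"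
  using L2_mult_absolutely_integrable[of f "\<lambda>x. 1"] L2_continuous[of "\<lambda>x. 1"] by simp

lemma L2_integrable: "L2 f \<Longrightarrow> f integrable_on {0..1}"
  using L2_absolutely_integrable absolutely_integrable_on_def by blast

lemma L2_add: "L2 f \<Longrightarrow> L2 g \<Longrightarrow> L2 (\<lambda>x. f x + g x)"
  using L2_mult_integrable[of f g]
  unfolding L2_def power2_sum mult.assoc
  by (intro conjI borel_measurable_add integrable_add integrable_on_mult_right) auto

lemma L2_cmult: "L2 f \<Longrightarrow> L2 (\<lambda>x. c * f x)"
  by (auto simp: L2_def power_mult_distrib intro!: integrable_on_mult_right)

lemma L2_diff: "L2 f \<Longrightarrow> L2 g \<Longrightarrow> L2 (\<lambda>x. f x - g x)"
  using L2_add[of f "\<lambda>x. -1 * g x"] L2_cmult[of g "-1"] by simp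

lemma L2_sum: "(\<And>i. i \<in> I \<Longrightarrow> L2 (f i)) \<Longrightarrow> L2 (\<lambda>x. \<Sum>i\<in>I. f i x)"
proof (induction I rule: infinite_finite_induct)
  case (insert i I)
  then show ?case by (simp add: L2_add)
qed (auto intro: L2_continuous)

lemma L2_mult_bounded:
  assumes "L2 f" "q \<in> borel_measurable (lebesgue_on {0..1})" "\<And>x. x \<in> {0..1} \<Longrightarrow> \<bar>q x\<bar> \<le> M"
  shows "L2 (\<lambda>x. q x * f x)"
  unfolding L2_def
proof
  show *: "(\<lambda>x. q x * f x) \<in> borel_measurable (lebesgue_on {0..1})"
    using assms L2_measurable by auto
  show "(\<lambda>x. (q x * f x)\<^sup>2) integrable_on {0..1}"
  proof (rule measurable_bounded_by_integrable_imp_integrable)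
    show "(\<lambda>x. (q x * f x)\<^sup>2) \<in> borel_measurable (lebesgue_on {0..1})"
      using * by auto
    show "(\<lambda>x. M\<^sup>2 * (f x)\<^sup>2) integrable_on {0..1}"
      using assms(1) by (intro integrable_on_mult_right) (auto simp: L2_def)
    show "norm ((q x * f x)\<^sup>2) \<le> M\<^sup>2 * (f x)\<^sup>2" if "x \<in> {0..1}" for x
      using assms(3)[OF that] by (auto simp: power_mult_distrib abs_le_square_iff[symmetric] intro!: mult_right_mono)
  qed auto
qed

lemma AE_zero_if_integral_square_zero:
  assumes "L2 f" "integral {0..1} (\<lambda>x. (f x)\<^sup>2) = 0"
  shows "AE x in lebesgue_on {0..1}. f x = 0"
proof -
  have int: "integrable (lebesgue_on {0..1}) (\<lambda>x. (f x)\<^sup>2)"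
    using L2_mult_absolutely_integrable[OF assms(1,1)]
    unfolding power2_eq_square by (simp add: integrable_restrict_space set_integrable_def)
  then have "integral\<^sup>L (lebesgue_on {0..1}) (\<lambda>x. (f x)\<^sup>2) = 0"
    using assms by (simp add: lebesgue_integral_eq_integral)
  then show ?thesis
    using integral_nonneg_eq_0_iff_AE[OF int] by simp
qed

section \<open>The inner product space of square-integrable functions modulo null sets\<close>

definition l2_eq :: "(real \<Rightarrow> real) \<Rightarrow> (real \<Rightarrow> real) \<Rightarrow> bool" where
  "l2_eq f g \<longleftrightarrow> L2 f \<and> L2 g \<and> (AE x in lebesgue_on {0..1}. f x = g x)"

\<comment> \<open>The relation is partial with domain \<open>L2\<close>, so the type consists of
  exactly the classes of square-integrable functions; values outside \<open>{0..1}\<close> are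
  ignored.\<close>
quotient_type l2 = "real \<Rightarrow> real" / partial: l2_eq
proof (rule part_equivpI)
  show "\<exists>f. l2_eq f f"
    by (rule exI[of _ "\<lambda>x. 0"]) (simp add: l2_eq_def L2_continuous)
  show "symp l2_eq"
    by (auto simp: symp_def l2_eq_def elim: eventually_mono)
  show "transp l2_eq"
    by (auto simp: transp_def l2_eq_def elim: eventually_elim2)
qed

lemma integral_mult_cong_AE:
  fixes f f' g g' :: "real \<Rightarrow> real"
  assumes "AE x in lebesgue_on {0..1}. f x = f' x" "AE x in lebesgue_on {0..1}. g x = g' x"
  shows "integral {0..1} (\<lambda>x. f x * g x) = integral {0..1} (\<lambda>x. f' x * g' x)"
  by (rule integral_cong_AE_lebesgue_on[where S="{0..1}"]) (use assms in \<open>auto elim: eventually_elim2\<close>)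

instantiation l2 :: real_inner
begin

lift_definition zero_l2 :: l2 is "\<lambda>x. 0"
  by (simp add: l2_eq_def L2_continuous)
lift_definition plus_l2 :: "l2 \<Rightarrow> l2 \<Rightarrow> l2" is "\<lambda>f g x. f x + g x"
  by (auto simp: l2_eq_def L2_add elim: eventually_elim2)
lift_definition minus_l2 :: "l2 \<Rightarrow> l2 \<Rightarrow> l2" is "\<lambda>f g x. f x - g x"
  by (auto simp: l2_eq_def L2_diff elim: eventually_elim2)
lift_definition scaleR_l2 :: "real \<Rightarrow> l2 \<Rightarrow> l2" is "\<lambda>c f x. c * f x"
  by (auto simp: l2_eq_def L2_cmult elim: eventually_mono)
definition uminus_l2 :: "l2 \<Rightarrow> l2" where "uminus_l2 f = scaleR (-1) f"
lift_definition inner_l2 :: "l2 \<Rightarrow> l2 \<Rightarrow> real" is "\<lambda>f g. integral {0..1} (\<lambda>x. f x * g x)"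
  by (auto simp: l2_eq_def intro!: integral_mult_cong_AE)
definition norm_l2 :: "l2 \<Rightarrow> real" where "norm_l2 f = sqrt (inner f f)"
definition sgn_l2 :: "l2 \<Rightarrow> l2" where "sgn_l2 f = scaleR (inverse (norm f)) f"
definition dist_l2 :: "l2 \<Rightarrow> l2 \<Rightarrow> real" where "dist_l2 f g = norm (f - g)"
definition "(uniformity :: (l2 \<times> l2) filter) = (INF e\<in>{0 <..}. principal {(x, y). dist x y < e})"
definition open_l2 :: "l2 set \<Rightarrow> bool" where
  "open_l2 U \<longleftrightarrow> (\<forall>x\<in>U. eventually (\<lambda>(x', y). x' = x \<longrightarrow> y \<in> U) uniformity)"

instance
proof
  fix f g h :: l2 and a b :: real
  show "f + g + h = f + (g + h)"
    by transfer (auto simp: l2_eq_def L2_add add.assoc)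
  show "f + g = g + f"
    by transfer (auto simp: l2_eq_def L2_add add.commute)
  show "0 + f = f"
    by transfer (auto simp: l2_eq_def)
  show "- f + f = 0"
    unfolding uminus_l2_def by transfer (auto simp: l2_eq_def L2_continuous)
  show "f - g = f + - g"
    unfolding uminus_l2_def by transfer (auto simp: l2_eq_def L2_diff)
  show "a *\<^sub>R (f + g) = a *\<^sub>R f + a *\<^sub>R g"
    by transfer (auto simp: l2_eq_def L2_add L2_cmult algebra_simps)
  show "(a + b) *\<^sub>R f = a *\<^sub>R f + b *\<^sub>R f"
    by transfer (auto simp: l2_eq_def L2_add L2_cmult algebra_simps)
  show "a *\<^sub>R b *\<^sub>R f = (a * b) *\<^sub>R f"
    by transfer (auto simp: l2_eq_def L2_add L2_cmult algebra_simps)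
  show "1 *\<^sub>R f = f"
    by transfer (auto simp: l2_eq_def)
  show "sgn f = inverse (norm f) *\<^sub>R f"
    by (simp add: sgn_l2_def)
  show "dist f g = norm (f - g)"
    by (simp add: dist_l2_def)
  show "f \<bullet> g = g \<bullet> f"
    by transfer (simp add: mult.commute)
  show "(f + g) \<bullet> h = f \<bullet> h + g \<bullet> h"
    by transfer (simp add: l2_eq_def distrib_right integral_add L2_mult_integrable)
  show "a *\<^sub>R f \<bullet> g = a * (f \<bullet> g)"
    by transfer (simp add: mult.assoc)
  show "0 \<le> f \<bullet> f"
    by transfer (auto simp: l2_eq_def intro!: integral_nonneg L2_mult_integrable)
  show "(f \<bullet> f = 0) = (f = 0)"
  proof
    show "f \<bullet> f = 0 \<Longrightarrow> f = 0"
      by transfer (auto simp: l2_eq_def L2_continuous power2_eq_square intro: AE_zero_if_integral_square_zero)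
  next
    assume "f = 0"
    then show "f \<bullet> f = 0"
      by (simp, transfer, simp)
  qed
  show "norm f = sqrt (f \<bullet> f)"
    by (simp add: norm_l2_def)
qed (simp_all add: uniformity_l2_def open_l2_def)

end

lemma l2_eq_refl_iff: "l2_eq f f \<longleftrightarrow> L2 f"
  by (simp add: l2_eq_def)

lemma abs_l2_add: "L2 f \<Longrightarrow> L2 g \<Longrightarrow> abs_l2 f + abs_l2 g = abs_l2 (\<lambda>x. f x + g x)"
  by (simp add: plus_l2.abs_eq l2_eq_refl_iff)

lemma abs_l2_diff: "L2 f \<Longrightarrow> L2 g \<Longrightarrow> abs_l2 f - abs_l2 g = abs_l2 (\<lambda>x. f x - g x)"
  by (simp add: minus_l2.abs_eq l2_eq_refl_iff)

lemma abs_l2_scaleR: "L2 f \<Longrightarrow> c *\<^sub>R abs_l2 f = abs_l2 (\<lambda>x. c * f x)"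
  by (simp add: scaleR_l2.abs_eq l2_eq_refl_iff)

lemma abs_l2_sum:
  "(\<And>i. i \<in> I \<Longrightarrow> L2 (f i)) \<Longrightarrow> (\<Sum>i\<in>I. abs_l2 (f i)) = abs_l2 (\<lambda>x. \<Sum>i\<in>I. f i x)"
proof (induction I rule: infinite_finite_induct)
  case (insert i I)
  then show ?case by (simp add: abs_l2_add L2_sum)
qed (auto simp: zero_l2_def)

lemma inner_abs_l2: "L2 f \<Longrightarrow> L2 g \<Longrightarrow> abs_l2 f \<bullet> abs_l2 g = integral {0..1} (\<lambda>x. f x * g x)"
  by (simp add: inner_l2.abs_eq l2_eq_refl_iff)

lemma norm_abs_l2: "L2 f \<Longrightarrow> norm (abs_l2 f) = L2norm f"
  by (simp add: norm_eq_sqrt_inner inner_abs_l2 L2norm_def power2_eq_square)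

lemma norm_abs_l2_square: "L2 f \<Longrightarrow> (norm (abs_l2 f))\<^sup>2 = integral {0..1} (\<lambda>x. (f x)\<^sup>2)"
  unfolding power2_norm_eq_inner by (simp add: inner_abs_l2 power2_eq_square)

lemma abs_l2_eq_iff:
  "L2 f \<Longrightarrow> L2 g \<Longrightarrow> abs_l2 f = abs_l2 g \<longleftrightarrow> (AE x in lebesgue_on {0..1}. f x = g x)"
  using Quotient3_rel[OF Quotient3_l2, of f g] by (simp add: l2_eq_def)

lemma abs_l2_cases:
  obtains f where "F = abs_l2 f" "L2 f"
  by (metis Quotient3_abs_rep[OF Quotient3_l2] Quotient3_rep_reflp[OF Quotient3_l2] l2_eq_refl_iff)

lemma norm_abs_l2_mult_le:
  assumes "L2 f" "L2 (\<lambda>x. q x * f x)" "0 \<le> d" "\<And>x. x \<in> {0..1} \<Longrightarrow> \<bar>q x\<bar> \<le> d"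
  shows "norm (abs_l2 (\<lambda>x. q x * f x)) \<le> d * norm (abs_l2 f)"
proof -
  have "(norm (abs_l2 (\<lambda>x. q x * f x)))\<^sup>2 \<le> integral {0..1} (\<lambda>x. d\<^sup>2 * (f x)\<^sup>2)"
    unfolding norm_abs_l2_square[OF assms(2)]
  proof (rule integral_le)
    show "(q x * f x)\<^sup>2 \<le> d\<^sup>2 * (f x)\<^sup>2" if "x \<in> {0..1}" for x
      using assms(3) assms(4)[OF that]
      by (auto simp: power_mult_distrib abs_le_square_iff[symmetric] intro!: mult_right_mono)
  qed (use assms in \<open>auto intro: integrable_on_mult_right L2_square_integrable\<close>)
  also have "\<dots> = (d * norm (abs_l2 f))\<^sup>2"
    by (simp add: power_mult_distrib norm_abs_l2_square assms)
  finally show ?thesis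
    using assms(3) by (simp add: power2_le_iff_abs_le)
qed

lemma norm_abs_l2_le_sup:
  assumes "L2 f" "0 \<le> d" "\<And>x. x \<in> {0..1} \<Longrightarrow> \<bar>f x\<bar> \<le> d"
  shows "norm (abs_l2 f) \<le> d"
proof -
  have one: "L2 (\<lambda>x. 1)"
    by (simp add: L2_continuous)
  have "norm (abs_l2 (\<lambda>x. 1)) = 1"
    by (simp add: norm_abs_l2[OF one] L2norm_def)
  then show ?thesis
    using norm_abs_l2_mult_le[OF one, of f d] assms by simp
qed

section \<open>Compact symmetric operators\<close>

text \<open>The underlying space is not assumed complete, so compactness is stated with the limit
  \<open>l\<close> existing in the space; all limits taken in this locale originate there.\<close>

locale compact_symmetric =
  fixes K :: "'a::real_inner \<Rightarrow> 'a"
  assumes bounded_linear: "bounded_linear K"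
    and symmetric: "K x \<bullet> y = x \<bullet> K y"
    and compact: "(\<And>n::nat. norm (X n) \<le> B) \<Longrightarrow> \<exists>l r. strict_mono r \<and> (\<lambda>n. K (X (r n))) \<longlonglongrightarrow> l"
begin

text \<open>Variational argument: a sequence in the unit ball of \<open>V\<close> along which
  \<open>norm (K x)\<close> approaches its supremum \<mu> consists of approximate eigenvectors of
  \<open>K\<close> squared for the value \<open>\<mu>\<^sup>2\<close>. Compactness turns it into an
  exact one, and factoring \<open>K\<close> squared minus \<open>\<mu>\<^sup>2\<close> gives an
  eigenvector of \<open>K\<close> itself. Closedness and invariance keep everything inside
  \<open>V\<close>.\<close>

lemma exists_eigenvector:
  assumes V: "subspace V" "closed V" "\<And>x. x \<in> V \<Longrightarrow> K x \<in> V" and x: "x \<in> V" "K x \<noteq> 0"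
  obtains \<kappa> g where "\<kappa> \<noteq> 0" "g \<noteq> 0" "g \<in> V" "K g = \<kappa> *\<^sub>R g"
proof -
  interpret bounded_linear K by (rule bounded_linear)
  obtain B where "B > 0" and B: "\<And>x. norm (K x) \<le> norm x * B"
    using pos_bounded by blast
  define S where "S = {norm (K x) |x. x \<in> V \<and> norm x \<le> 1}"
  define \<mu> where "\<mu> = Sup S"
  have "bdd_above S"
  proof (rule bdd_aboveI)
    fix s assume "s \<in> S"
    then obtain x where "s = norm (K x)" "norm x \<le> 1" by (auto simp: S_def)
    then show "s \<le> B"
      using order_trans[OF B[of x] mult_right_mono[of "norm x" 1 B]] \<open>B > 0\<close> by simp
  qed
  then have le_\<mu>: "norm (K x) \<le> \<mu>" if "x \<in> V" "norm x \<le> 1" for x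
    unfolding \<mu>_def using that by (intro cSup_upper) (auto simp: S_def)
  have norm_K_le: "norm (K x) \<le> \<mu> * norm x" if "x \<in> V" for x
  proof (cases "x = 0")
    case False
    then have "norm (K (x /\<^sub>R norm x)) \<le> \<mu>"
      using that V(1) by (intro le_\<mu>) (auto simp: subspace_scale)
    then show ?thesis
      using False by (simp add: scaleR field_simps)
  qed (simp add: zero)
  have "\<mu> > 0"
  proof -
    have "0 < \<mu> * norm x"
      using norm_K_le[OF x(1)] x(2) by (meson less_le_trans zero_less_norm_iff)
    then show ?thesis
      by (simp add: zero_less_mult_iff)
  qed
  have "\<exists>f. f \<in> V \<and> norm f \<le> 1 \<and> \<mu> - inverse (real (Suc n)) < norm (K f)" for n
  proof -
    have "S \<noteq> {}"
      using subspace_0[OF V(1)] by (auto simp: S_def)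
    then have "\<exists>s\<in>S. \<mu> - inverse (real (Suc n)) < s"
      using \<open>bdd_above S\<close> by (subst less_cSup_iff[symmetric]) (auto simp: \<mu>_def)
    then show ?thesis
      by (auto simp: S_def)
  qed
  then obtain f where f: "\<And>n. f n \<in> V" "\<And>n. norm (f n) \<le> 1"
      "\<And>n. \<mu> - inverse (real (Suc n)) < norm (K (f n))"
    by metis
  have lim_\<mu>: "(\<lambda>n. norm (K (f n))) \<longlonglongrightarrow> \<mu>"
  proof (rule tendsto_sandwich)
    show "(\<lambda>n. \<mu> - inverse (real (Suc n))) \<longlonglongrightarrow> \<mu>"
      using tendsto_diff[OF tendsto_const LIMSEQ_inverse_real_of_nat, of \<mu>] by simp
    show "\<forall>\<^sub>F n in sequentially. \<mu> - inverse (real (Suc n)) \<le> norm (K (f n))"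
      using f(3) by (intro always_eventually allI less_imp_le)
    show "\<forall>\<^sub>F n in sequentially. norm (K (f n)) \<le> \<mu>"
      using le_\<mu>[OF f(1,2)] by (intro always_eventually allI)
  qed (rule tendsto_const)
  \<comment> \<open>In the expanded square, symmetry turns the mixed term
    \<open>K (K (f n)) \<bullet> f n\<close> into the squared norm of \<open>K (f n)\<close>; the
    first term is bounded by applying \<open>norm_K_le\<close> to \<open>K (f n)\<close>, the last
    by \<open>norm (f n) \<le> 1\<close>.\<close>
  have le2: "(norm (K (K (f n)) - \<mu>\<^sup>2 *\<^sub>R f n))\<^sup>2 \<le> \<mu>\<^sup>2 * (\<mu>\<^sup>2 - (norm (K (f n)))\<^sup>2)" for n
  proof -
    have "(norm (K (K (f n)) - \<mu>\<^sup>2 *\<^sub>R f n))\<^sup>2 =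
        (norm (K (K (f n))))\<^sup>2 - 2 * \<mu>\<^sup>2 * (norm (K (f n)))\<^sup>2 + \<mu>\<^sup>2 * (\<mu>\<^sup>2 * (norm (f n))\<^sup>2)"
      unfolding power2_norm_eq_inner
      by (simp add: inner_diff_left inner_diff_right inner_commute symmetric[of "K (f n)" "f n"]
          symmetric[of "f n" "K (f n)", symmetric] algebra_simps power2_eq_square)
    moreover have "(norm (K (K (f n))))\<^sup>2 \<le> \<mu>\<^sup>2 * (norm (K (f n)))\<^sup>2"
      using power_mono[OF norm_K_le[OF V(3)[OF f(1)[of n]]], of 2] by (simp add: power_mult_distrib)
    moreover have "\<mu>\<^sup>2 * (\<mu>\<^sup>2 * (norm (f n))\<^sup>2) \<le> \<mu>\<^sup>2 * (\<mu>\<^sup>2 * 1)"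
      using f(2)[of n] by (intro mult_left_mono) (auto simp: power_le_one)
    ultimately show ?thesis
      by (simp add: algebra_simps)
  qed
  have lim2: "(\<lambda>n. \<mu>\<^sup>2 * (\<mu>\<^sup>2 - (norm (K (f n)))\<^sup>2)) \<longlonglongrightarrow> 0"
    using tendsto_mult[OF tendsto_const tendsto_diff[OF tendsto_const tendsto_power[OF lim_\<mu>]], of "\<mu>\<^sup>2" "\<mu>\<^sup>2" 2]
    by simp
  have "(\<lambda>n. (norm (K (K (f n)) - \<mu>\<^sup>2 *\<^sub>R f n))\<^sup>2) \<longlonglongrightarrow> 0"
    by (rule tendsto_sandwich[OF _ _ tendsto_const lim2]) (simp_all add: le2)
  from tendsto_real_sqrt[OF this] have "(\<lambda>n. norm (K (K (f n)) - \<mu>\<^sup>2 *\<^sub>R f n)) \<longlonglongrightarrow> 0"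
    by simp
  then have "(\<lambda>n. K (K (f n)) - \<mu>\<^sup>2 *\<^sub>R f n) \<longlonglongrightarrow> 0"
    by (simp add: tendsto_norm_zero_iff)
  \<comment> \<open>One more application of \<open>K\<close>, because compactness makes only
    \<open>K (f (r n))\<close> converge, not \<open>f (r n)\<close>.\<close>
  then have lim0: "(\<lambda>n. K (K (K (f n))) - \<mu>\<^sup>2 *\<^sub>R K (f n)) \<longlonglongrightarrow> 0"
    using tendsto[of "\<lambda>n. K (K (f n)) - \<mu>\<^sup>2 *\<^sub>R f n" 0] by (simp add: diff scaleR zero)
  obtain g r where r: "strict_mono r" and g: "(\<lambda>n. K (f (r n))) \<longlonglongrightarrow> g"
    using compact[of f 1] f(2) by auto
  have "g \<in> V"
    using closed_sequentially[OF V(2) _ g] V(3) f(1) by auto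
  have "norm g = \<mu>"
    using LIMSEQ_unique[OF tendsto_norm[OF g]] LIMSEQ_subseq_LIMSEQ[OF lim_\<mu> r] by (simp add: o_def)
  have "(\<lambda>n. K (K (K (f (r n)))) - \<mu>\<^sup>2 *\<^sub>R K (f (r n))) \<longlonglongrightarrow> K (K g) - \<mu>\<^sup>2 *\<^sub>R g"
    by (intro tendsto_intros tendsto g)
  then have "K (K g) - \<mu>\<^sup>2 *\<^sub>R g = 0"
    by (rule LIMSEQ_unique) (use LIMSEQ_subseq_LIMSEQ[OF lim0 r] in \<open>simp add: o_def\<close>)
  then have KKg: "K (K g) = \<mu>\<^sup>2 *\<^sub>R g"
    by simp
  \<comment> \<open>\<open>(K - \<mu>) (K + \<mu>) g = 0\<close>: either the inner factor already
    annihilates \<open>g\<close>, with eigenvalue \<open>- \<mu>\<close>, or its value at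
    \<open>g\<close> is an eigenvector for \<mu>.\<close>
  show thesis
  proof (cases "K g + \<mu> *\<^sub>R g = 0")
    case True
    then have "K g = (- \<mu>) *\<^sub>R g"
      by (simp add: eq_neg_iff_add_eq_0)
    then show thesis
      using \<open>\<mu> > 0\<close> \<open>norm g = \<mu>\<close> \<open>g \<in> V\<close> by (intro that[of "- \<mu>" g]) auto
  next
    case False
    have "K (K g + \<mu> *\<^sub>R g) = \<mu> *\<^sub>R (K g + \<mu> *\<^sub>R g)"
      by (simp add: add scaleR KKg power2_eq_square algebra_simps)
    then show thesis
      using \<open>\<mu> > 0\<close> False \<open>g \<in> V\<close> V by (intro that[of \<mu> "K g + \<mu> *\<^sub>R g"]) (auto intro!: subspace_add subspace_scale)
  qed
qed

end

section \<open>Orthonormal sequences, Bessel's inequality and expansion in eigenvectors\<close>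

locale orthonormal =
  fixes e :: "nat \<Rightarrow> 'a::real_inner"
  assumes orthonormal: "e m \<bullet> e n = (if m = n then 1 else 0)"
begin

definition proj :: "nat \<Rightarrow> 'a \<Rightarrow> 'a" where
  "proj N x = (\<Sum>n<N. (x \<bullet> e n) *\<^sub>R e n)"

lemma norm_sum_square: "(norm (\<Sum>n<N. c n *\<^sub>R e n))\<^sup>2 = (\<Sum>n<N. (c n)\<^sup>2)"
proof -
  have "(norm (\<Sum>n<N. c n *\<^sub>R e n))\<^sup>2 = (\<Sum>n<N. \<Sum>m<N. if m = n then c n * c m else 0)"
    unfolding power2_norm_eq_inner inner_sum_left inner_sum_right
    by (intro sum.cong refl) (simp add: orthonormal)
  then show ?thesis
    by (simp add: power2_eq_square)
qed

lemma inner_proj: "proj N x \<bullet> e n = (if n < N then x \<bullet> e n else 0)"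
  by (simp add: proj_def inner_sum_left orthonormal if_distrib sum.delta cong: if_cong)

lemma norm_residual_square: "(norm (x - proj N x))\<^sup>2 = (norm x)\<^sup>2 - (\<Sum>n<N. (x \<bullet> e n)\<^sup>2)"
proof -
  have "x \<bullet> proj N x = (\<Sum>n<N. (x \<bullet> e n)\<^sup>2)"
    by (simp add: proj_def inner_sum_right power2_eq_square)
  moreover have "proj N x \<bullet> proj N x = (\<Sum>n<N. (x \<bullet> e n)\<^sup>2)"
    using norm_sum_square[where c="\<lambda>n. x \<bullet> e n"] by (simp add: proj_def power2_norm_eq_inner)
  ultimately show ?thesis
    by (simp add: power2_norm_eq_inner inner_diff_left inner_diff_right inner_commute)
qed

lemma bessel: "(\<Sum>n<N. (x \<bullet> e n)\<^sup>2) \<le> (norm x)\<^sup>2"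
  using norm_residual_square[of x N] by (metis diff_ge_0_iff_ge zero_le_power2)

text \<open>Monotonicity upgrades convergence of the residuals along a subsequence, which is all
  that compactness provides, to convergence of the whole sequence.\<close>

lemma norm_residual_antimono: "M \<le> N \<Longrightarrow> norm (x - proj N x) \<le> norm (x - proj M x)"
  by (rule power2_le_imp_le) (auto simp: norm_residual_square intro!: sum_mono2)

lemma norm_residual_le: "norm (x - proj N x) \<le> norm x"
  using norm_residual_antimono[of 0 N x] by (simp add: proj_def)

text \<open>The source of every bound on the evolution that is uniform in the cutoff
  \<open>N\<close>: a bounded multiplier acts boundedly by Bessel's inequality, whatever the number
  of terms.\<close>

lemma norm_multiplier_le:
  assumes "\<And>n. \<bar>m n\<bar> \<le> C" "0 \<le> C"
  shows "norm (\<Sum>n<N. (m n * (x \<bullet> e n)) *\<^sub>R e n) \<le> C * norm x"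
proof (rule power2_le_imp_le)
  have "(norm (\<Sum>n<N. (m n * (x \<bullet> e n)) *\<^sub>R e n))\<^sup>2 \<le> (\<Sum>n<N. C\<^sup>2 * (x \<bullet> e n)\<^sup>2)"
    unfolding norm_sum_square power_mult_distrib
    using assms by (intro sum_mono mult_right_mono) (auto simp: abs_le_square_iff[symmetric])
  also have "\<dots> \<le> (C * norm x)\<^sup>2"
    using bessel[of x N] by (simp add: sum_distrib_left[symmetric] power_mult_distrib mult_left_mono)
  finally show "(norm (\<Sum>n<N. (m n * (x \<bullet> e n)) *\<^sub>R e n))\<^sup>2 \<le> (C * norm x)\<^sup>2" .
qed (use assms in auto)

end

text \<open>\<open>K\<close> vanishes on the orthogonal complement \<open>V\<close> of all
  \<open>e n\<close>, since otherwise \<open>exists_eigenvector\<close> would produce an eigenvector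
  there. Without completeness the sums \<open>proj N h\<close> need not converge, so the argument
  looks at \<open>K (h - proj N h)\<close>, the residual of \<open>K h\<close>: the arguments are
  bounded, hence a subsequence of the images converges. This is why only elements of the range of
  \<open>K\<close> are expanded.\<close>

theorem (in compact_symmetric) eigenvector_expansion:
  assumes "orthonormal e" and eig: "\<And>n. K (e n) = \<kappa> n *\<^sub>R e n"
    and complete: "\<And>c g. c \<noteq> 0 \<Longrightarrow> K g = c *\<^sub>R g \<Longrightarrow> (\<And>n. g \<bullet> e n = 0) \<Longrightarrow> g = 0"
  shows "(\<lambda>N. orthonormal.proj e N (K h)) \<longlonglongrightarrow> K h"
proof -
  interpret orthonormal e by fact
  interpret bounded_linear K by (rule bounded_linear)
  define V where "V = {x. \<forall>n. x \<bullet> e n = 0}"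
  have V: "subspace V" "closed V"
    unfolding V_def
    by (simp add: subspace_def inner_add_left)
      (intro closed_Collect_all closed_Collect_eq continuous_on_inner continuous_on_id continuous_on_const)
  have VK: "K x \<in> V" if "x \<in> V" for x
    using that by (simp add: V_def symmetric eig)
  have K_zero: "K x = 0" if "x \<in> V" for x
  proof (rule ccontr)
    assume "K x \<noteq> 0"
    then obtain c g where "c \<noteq> 0" "g \<noteq> 0" "g \<in> V" "K g = c *\<^sub>R g"
      using exists_eigenvector[OF V VK \<open>x \<in> V\<close>] by blast
    then show False
      using complete by (auto simp: V_def)
  qed
  have commute: "K h - proj N (K h) = K (h - proj N h)" for N
    by (simp add: diff proj_def sum scaleR eig symmetric mult.commute)
  obtain g r where r: "strict_mono r" and g: "(\<lambda>n. K (h - proj (r n) h)) \<longlonglongrightarrow> g"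
    using compact[of "\<lambda>n. h - proj n h" "norm h"] norm_residual_le by blast
  have "g \<in> V"
    unfolding V_def
  proof safe
    fix n
    have "\<forall>\<^sub>F N in sequentially. K (h - proj (r N) h) \<bullet> e n = 0"
      unfolding eventually_sequentially
    proof (intro exI allI impI)
      fix N assume "Suc n \<le> N"
      then have "n < r N"
        using seq_suble[OF r, of N] by simp
      then show "K (h - proj (r N) h) \<bullet> e n = 0"
        by (simp add: commute[symmetric] inner_diff_left inner_proj)
    qed
    then have "(\<lambda>N. K (h - proj (r N) h) \<bullet> e n) \<longlonglongrightarrow> 0"
      by (rule tendsto_eventually)
    then show "g \<bullet> e n = 0"
      using LIMSEQ_unique tendsto_inner[OF g tendsto_const] by blast
  qed
  \<comment> \<open>Moving \<open>K\<close> to the other side meets \<open>K g = 0\<close>; so the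
    limit \<open>g\<close> is orthogonal to the sequence converging to it, hence to itself.\<close>
  then have "K (h - proj (r n) h) \<bullet> g = 0" for n
    by (simp add: symmetric K_zero)
  then have "g \<bullet> g = 0"
    using LIMSEQ_unique[OF tendsto_inner[OF g tendsto_const, of g], of 0] by simp
  then have lim0: "(\<lambda>n. norm (K h - proj (r n) (K h))) \<longlonglongrightarrow> 0"
    using tendsto_norm[OF g] by (simp add: commute)
  have "(\<lambda>N. norm (K h - proj N (K h))) \<longlonglongrightarrow> 0"
  proof (rule LIMSEQ_I)
    fix \<epsilon> :: real assume "\<epsilon> > 0"
    then obtain n where n: "norm (K h - proj (r n) (K h)) < \<epsilon>"
      using LIMSEQ_D[OF lim0] by fastforce
    show "\<exists>N0. \<forall>N\<ge>N0. norm (norm (K h - proj N (K h)) - 0) < \<epsilon>"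
      using norm_residual_antimono[of "r n" _ "K h"] n by (intro exI[of _ "r n"]) fastforce
  qed
  then have "(\<lambda>N. K h - proj N (K h)) \<longlonglongrightarrow> 0"
    by (simp add: tendsto_norm_zero_iff)
  from tendsto_diff[OF tendsto_const[of "K h"] this] show ?thesis
    by simp
qed

section \<open>Functions with a second derivative in the Caratheodory sense\<close>

definition second_deriv :: "(real \<Rightarrow> real) \<Rightarrow> (real \<Rightarrow> real) \<Rightarrow> (real \<Rightarrow> real) \<Rightarrow> bool" where
  "second_deriv y \<psi> h \<longleftrightarrow>
     (\<forall>x\<in>{0..1}. (y has_real_derivative \<psi> x) (at x within {0..1})) \<and>
     (\<forall>x\<in>{0..1}. \<psi> x = \<psi> 0 + integral {0..x} h)"

definition double_integral :: "(real \<Rightarrow> real) \<Rightarrow> real \<Rightarrow> real" where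
  "double_integral h x = integral {0..x} (\<lambda>s. integral {0..s} h)"

lemma integrable_on_initial_interval:
  fixes h :: "real \<Rightarrow> real"
  shows "h integrable_on {0..1} \<Longrightarrow> x \<in> {0..1} \<Longrightarrow> h integrable_on {0..x}"
  by (rule integrable_on_subinterval) auto

lemma continuous_on_initial_integral:
  fixes h :: "real \<Rightarrow> real"
  shows "h integrable_on {0..1} \<Longrightarrow> continuous_on {0..1} (\<lambda>x. integral {0..x} h)"
  by (rule indefinite_integral_continuous_1)

lemma second_derivD:
  assumes "second_deriv y \<psi> h" "x \<in> {0..1}"
  shows "(y has_real_derivative \<psi> x) (at x within {0..1})" "\<psi> x = \<psi> 0 + integral {0..x} h"
  using assms unfolding second_deriv_def by blast+

lemma second_deriv_continuous: "second_deriv y \<psi> h \<Longrightarrow> continuous_on {0..1} y"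
  by (rule DERIV_continuous_on) (rule second_derivD)

lemma second_deriv_continuous_deriv:
  assumes "second_deriv y \<psi> h" "h integrable_on {0..1}"
  shows "continuous_on {0..1} \<psi>"
proof -
  have "continuous_on {0..1} (\<lambda>x. \<psi> 0 + integral {0..x} h)"
    by (intro continuous_on_add continuous_on_const continuous_on_initial_integral assms)
  then show ?thesis
    by (rule continuous_on_eq) (rule second_derivD(2)[OF assms(1), symmetric])
qed

lemma second_deriv_add:
  assumes "second_deriv y \<psi> h" "second_deriv z \<eta> k" "h integrable_on {0..1}" "k integrable_on {0..1}"
  shows "second_deriv (\<lambda>x. y x + z x) (\<lambda>x. \<psi> x + \<eta> x) (\<lambda>x. h x + k x)"
  unfolding second_deriv_def
proof (intro conjI ballI)
  fix x :: real assume x: "x \<in> {0..1}"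
  then show "((\<lambda>x. y x + z x) has_real_derivative \<psi> x + \<eta> x) (at x within {0..1})"
    by (intro DERIV_add second_derivD(1)[OF assms(1)] second_derivD(1)[OF assms(2)])
  show "\<psi> x + \<eta> x = \<psi> 0 + \<eta> 0 + integral {0..x} (\<lambda>x. h x + k x)"
    unfolding second_derivD(2)[OF assms(1) x] second_derivD(2)[OF assms(2) x]
    using x assms by (simp add: integral_add integrable_on_initial_interval)
qed

lemma second_deriv_cmult:
  assumes "second_deriv y \<psi> h"
  shows "second_deriv (\<lambda>x. c * y x) (\<lambda>x. c * \<psi> x) (\<lambda>x. c * h x)"
  unfolding second_deriv_def
proof (intro conjI ballI)
  fix x :: real assume x: "x \<in> {0..1}"
  then show "((\<lambda>x. c * y x) has_real_derivative c * \<psi> x) (at x within {0..1})"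
    by (intro DERIV_cmult second_derivD(1)[OF assms])
  show "c * \<psi> x = c * \<psi> 0 + integral {0..x} (\<lambda>x. c * h x)"
    unfolding second_derivD(2)[OF assms x] by (simp add: algebra_simps)
qed

lemma second_deriv_cong_AE:
  assumes "second_deriv y \<psi> h" "AE x in lebesgue_on {0..1}. h x = k x"
  shows "second_deriv y \<psi> k"
proof -
  have "integral {0..x} h = integral {0..x} k" if "x \<in> {0..1}" for x
    using that by (intro integral_cong_AE_lebesgue_on[OF assms(2)]) auto
  then show ?thesis
    using assms(1) by (auto simp only: second_deriv_def)
qed

lemma second_deriv_cong:
  assumes "second_deriv y \<psi> h" "\<And>x. x \<in> {0..1} \<Longrightarrow> y x = z x" "\<And>x. x \<in> {0..1} \<Longrightarrow> h x = k x"
  shows "second_deriv z \<psi> k"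
  unfolding second_deriv_def
proof (intro conjI ballI)
  fix x :: real assume x: "x \<in> {0..1}"
  have "(y has_real_derivative \<psi> x) (at x within {0..1})"
    by (rule second_derivD(1)[OF assms(1) x])
  then show "(z has_real_derivative \<psi> x) (at x within {0..1})"
    by (rule has_field_derivative_transform_within[of _ _ _ _ 1]) (use x assms(2) in auto)
  have "integral {0..x} h = integral {0..x} k"
    using x assms(3) by (intro integral_cong) auto
  then show "\<psi> x = \<psi> 0 + integral {0..x} k"
    using second_derivD(2)[OF assms(1) x] by (simp only:)
qed

lemma second_deriv_double_integral:
  assumes "h integrable_on {0..1}"
  shows "second_deriv (\<lambda>x. a + b * x + double_integral h x) (\<lambda>x. b + integral {0..x} h) h"
  unfolding second_deriv_def double_integral_def
proof (intro conjI ballI)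
  fix x :: real assume x: "x \<in> {0..1}"
  have "((\<lambda>u. integral {0..u} (\<lambda>s. integral {0..s} h)) has_real_derivative integral {0..x} h) (at x within {0..1})"
    by (rule integral_has_real_derivative[OF continuous_on_initial_integral[OF assms] x])
  then show "((\<lambda>x. a + b * x + integral {0..x} (\<lambda>s. integral {0..s} h)) has_real_derivative
      b + integral {0..x} h) (at x within {0..1})"
    by (auto intro!: derivative_eq_intros)
qed simp

text \<open>The two sides have the same derivative and the same value at 0. This turns the
  differential equation into an integral equation, to which the Volterra estimates apply.\<close>

lemma second_deriv_eq_double_integral:
  assumes "second_deriv y \<psi> h" "h integrable_on {0..1}" "x \<in> {0..1}"
  shows "y x = y 0 + \<psi> 0 * x + double_integral h x"
proof -
  define w where "w x = y x - (y 0 + \<psi> 0 * x + double_integral h x)" for x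
  have "(w has_real_derivative 0) (at u within {0..1})" if "u \<in> {0..1}" for u
  proof -
    have "(y has_real_derivative \<psi> 0 + integral {0..u} h) (at u within {0..1})"
      using second_derivD[OF assms(1) that] by (simp only:)
    moreover have "((\<lambda>x. y 0 + \<psi> 0 * x + double_integral h x) has_real_derivative \<psi> 0 + integral {0..u} h)
        (at u within {0..1})"
      by (rule second_derivD(1)[OF second_deriv_double_integral[OF assms(2)] that])
    ultimately show ?thesis
      unfolding w_def using DERIV_diff[of y] by fastforce
  qed
  then obtain c where "\<And>u. u \<in> {0..1} \<Longrightarrow> w u = c"
    using has_field_derivative_zero_constant[of "{0..1}" w] by auto
  then have "w x = w 0"
    using assms(3) by simp
  then show ?thesis
    by (simp add: w_def double_integral_def)
qed

lemma double_integral_continuous: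
  assumes "h integrable_on {0..1}"
  shows "continuous_on {0..1} (double_integral h)"
  using second_deriv_continuous[OF second_deriv_double_integral[OF assms, of 0 0]] by simp

lemma double_integral_add:
  assumes "h integrable_on {0..1}" "k integrable_on {0..1}" "x \<in> {0..1}"
  shows "double_integral (\<lambda>s. h s + k s) x = double_integral h x + double_integral k x"
proof -
  have "integral {0..s} (\<lambda>s. h s + k s) = integral {0..s} h + integral {0..s} k" if "s \<in> {0..x}" for s
    using assms that by (intro integral_add integrable_on_initial_interval[OF assms(1)] integrable_on_initial_interval[OF assms(2)]) auto
  then have "double_integral (\<lambda>s. h s + k s) x = integral {0..x} (\<lambda>s. integral {0..s} h + integral {0..s} k)"
    unfolding double_integral_def by (intro integral_cong) auto
  also have "\<dots> = double_integral h x + double_integral k x"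
    unfolding double_integral_def
    by (intro integral_add integrable_on_initial_interval[OF integrable_continuous_interval] continuous_on_initial_integral assms)
  finally show ?thesis .
qed

lemma double_integral_cmult: "double_integral (\<lambda>s. c * h s) x = c * double_integral h x"
  by (simp add: double_integral_def)

lemma double_integral_diff:
  assumes "h integrable_on {0..1}" "k integrable_on {0..1}" "x \<in> {0..1}"
  shows "double_integral (\<lambda>s. h s - k s) x = double_integral h x - double_integral k x"
  using double_integral_add[OF assms(1) integrable_on_mult_right[OF assms(2), of "-1"] assms(3)]
    double_integral_cmult[of "-1" k x] by simp

lemma abs_integral_le:
  fixes f g :: "real \<Rightarrow> real"
  assumes "f integrable_on S" "g integrable_on S" "\<And>x. x \<in> S \<Longrightarrow> \<bar>f x\<bar> \<le> g x"
  shows "\<bar>integral S f\<bar> \<le> integral S g"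
  using Henstock_Kurzweil_Integration.integral_norm_bound_integral[of f S g] assms by simp

section \<open>Integration by parts for absolutely continuous functions\<close>

lemma integration_by_parts_absolutely_continuous:
  fixes h \<psi> z z' :: "real \<Rightarrow> real"
  assumes h: "h absolutely_integrable_on {0..1}"
    and \<psi>: "\<And>x. x \<in> {0..1} \<Longrightarrow> \<psi> x = \<psi> 0 + integral {0..x} h"
    and z: "\<And>x. x \<in> {0..1} \<Longrightarrow> (z has_real_derivative z' x) (at x within {0..1})"
    and z': "continuous_on {0..1} z'"
  shows "integral {0..1} (\<lambda>x. h x * z x) + integral {0..1} (\<lambda>x. \<psi> x * z' x) = \<psi> 1 * z 1 - \<psi> 0 * z 0"
proof -
  have hi: "h integrable_on {0..1}" and ai: "(\<lambda>x. \<bar>h x\<bar>) integrable_on {0..1}"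
    using h by (auto simp: absolutely_integrable_on_def)
  define H where "H x = integral {0..x} (\<lambda>x. \<bar>h x\<bar>)" for x
  have H_cont: "continuous_on {0..1} H"
    unfolding H_def by (rule continuous_on_initial_integral[OF ai])
  have z_cont: "continuous_on {0..1} z"
    using z by (meson DERIV_continuous_on)
  have \<psi>_cont: "continuous_on {0..1} \<psi>"
    by (rule continuous_on_eq[of _ "\<lambda>x. \<psi> 0 + integral {0..x} h"])
      (rule \<psi>[symmetric] continuous_on_add continuous_on_const continuous_on_initial_integral hi | assumption)+
  obtain C where C: "\<And>x. x \<in> {0..1} \<Longrightarrow> \<bar>z' x\<bar> \<le> C"
    using compact_continuous_image[OF z' compact_Icc, THEN compact_imp_bounded] unfolding bounded_iff by fastforce
  have "0 \<le> C"
    using C[of 0] by simp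
  have hz: "(\<lambda>x. h x * w x) integrable_on {0..1}" if "continuous_on {0..1} w" for w
  proof -
    have "(\<lambda>x. w x * h x) absolutely_integrable_on {0..1}"
      by (rule absolutely_integrable_bounded_measurable_product_real)
        (use that h in \<open>auto intro: continuous_imp_measurable_on_sets_lebesgue compact_imp_bounded compact_continuous_image\<close>)
    then show ?thesis
      by (simp add: absolutely_integrable_on_def mult.commute)
  qed
  have \<psi>z': "(\<lambda>x. \<psi> x * z' x) integrable_on {0..1}"
    by (intro integrable_continuous_interval continuous_on_mult \<psi>_cont z')
  define F where "F x = h x * z x + \<psi> x * z' x" for x
  have F: "F integrable_on {0..1}"
    unfolding F_def by (intro integrable_add hz \<psi>z' z_cont)
  define D where "D x = \<psi> x * z x - integral {0..x} F" for x
  have split: "integral {0..b} f - integral {0..a} f = integral {a..b} f"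
    if "f integrable_on {0..1}" "0 \<le> a" "a \<le> b" "b \<le> 1" for f :: "real \<Rightarrow> real" and a b
    using Henstock_Kurzweil_Integration.integral_combine[of 0 a b f] integrable_on_initial_interval[OF that(1), of b] that by simp
  have sub: "f integrable_on {a..b}" if "f integrable_on {0..1}" "0 \<le> a" "b \<le> 1" for f :: "real \<Rightarrow> real" and a b
    using that by (intro integrable_on_subinterval[OF that(1)]) auto
  \<comment> \<open>Freezing \<open>z\<close> at \<open>b\<close> and \<psi> at \<open>a\<close>
    writes the increment of \<open>\<psi> * z\<close> exactly as an integral of
    \<open>h x * z b + \<psi> a * z' x\<close>. Against \<open>F\<close> this leaves
    \<open>(z b - z x) * h x\<close> and \<open>z' x * (\<psi> a - \<psi> x)\<close>; each of the
    two integrates to at most \<open>C * (b - a) * (H b - H a)\<close>.\<close>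
  have increment: "\<bar>D b - D a\<bar> \<le> 2 * C * (b - a) * (H b - H a)" if ab: "0 \<le> a" "a \<le> b" "b \<le> 1" for a b
  proof -
    have \<psi>d: "\<psi> x - \<psi> a = integral {a..x} h" if "x \<in> {a..b}" for x
      using \<psi>[of x] \<psi>[of a] split[OF hi, of a x] that ab by simp
    have zd: "(z' has_integral z x - z y) {y..x}" if "a \<le> y" "y \<le> x" "x \<le> b" for x y
    proof (rule fundamental_theorem_of_calculus[OF that(2)])
      fix u assume "u \<in> {y..x}"
      then show "(z has_vector_derivative z' u) (at u within {y..x})"
        using that ab z[of u] by (intro has_vector_derivative_within_subset[OF z[of u, unfolded has_real_derivative_iff_has_vector_derivative]]) auto
    qed
    have i1: "(\<lambda>x. h x * z b) integrable_on {a..b}" "(\<lambda>x. \<psi> a * z' x) integrable_on {a..b}"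
      by (rule sub[OF hz[OF continuous_on_const]], use ab in simp_all,
          rule sub[OF integrable_continuous_interval[OF continuous_on_mult[OF continuous_on_const z']]], use ab in simp_all)
    have "\<psi> b * z b - \<psi> a * z a = (\<psi> b - \<psi> a) * z b + \<psi> a * (z b - z a)"
      by (simp add: algebra_simps)
    also have "\<dots> = integral {a..b} (\<lambda>x. h x * z b + \<psi> a * z' x)"
      using \<psi>d[of b] zd[of a b] ab i1 by (subst integral_add) (auto simp: integral_unique)
    finally have "D b - D a = integral {a..b} (\<lambda>x. (h x * z b + \<psi> a * z' x) - F x)"
      unfolding D_def using split[OF F, of a b] ab i1 sub[OF F]
      by (subst integral_diff) (auto intro: integrable_add)
    also have "\<bar>\<dots>\<bar> \<le> integral {a..b} (\<lambda>x. C * (b - a) * \<bar>h x\<bar> + C * (H b - H a))"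
    proof (rule abs_integral_le)
      show "(\<lambda>x. h x * z b + \<psi> a * z' x - F x) integrable_on {a..b}"
        using i1 sub[OF F] ab by (intro integrable_diff integrable_add)
      show "(\<lambda>x. C * (b - a) * \<bar>h x\<bar> + C * (H b - H a)) integrable_on {a..b}"
        using sub[OF ai] ab by (intro integrable_add integrable_on_mult_right integrable_const_ivl)
      fix x assume x: "x \<in> {a..b}"
      have zx: "(z' has_integral z b - z x) {x..b}"
        using zd[of x b] x by simp
      have "\<bar>integral {x..b} z'\<bar> \<le> integral {x..b} (\<lambda>_. C)"
        using x ab C by (intro abs_integral_le has_integral_integrable[OF zx] integrable_const_ivl) auto
      then have "\<bar>z b - z x\<bar> \<le> integral {x..b} (\<lambda>_. C)"
        by (simp only: integral_unique[OF zx])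
      also have "\<dots> \<le> C * (b - a)"
        using x \<open>0 \<le> C\<close> by (simp add: mult.commute mult_left_mono)
      finally have 1: "\<bar>z b - z x\<bar> \<le> C * (b - a)" .
      have "\<bar>\<psi> a - \<psi> x\<bar> \<le> integral {a..x} (\<lambda>x. \<bar>h x\<bar>)"
        using \<psi>d[OF x] x ab abs_integral_le[OF sub[OF hi, of a x] sub[OF ai, of a x]] by simp
      also have "\<dots> \<le> integral {a..b} (\<lambda>x. \<bar>h x\<bar>)"
        using x ab by (intro integral_subset_le sub[OF ai]) auto
      also have "\<dots> = H b - H a"
        using split[OF ai, of a b] ab by (simp add: H_def)
      finally have 2: "\<bar>\<psi> a - \<psi> x\<bar> \<le> H b - H a" .
      have "h x * z b + \<psi> a * z' x - F x = (z b - z x) * h x + z' x * (\<psi> a - \<psi> x)"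
        by (simp add: F_def algebra_simps)
      also have "\<bar>\<dots>\<bar> \<le> \<bar>z b - z x\<bar> * \<bar>h x\<bar> + \<bar>z' x\<bar> * \<bar>\<psi> a - \<psi> x\<bar>"
        unfolding abs_mult[symmetric] by (rule abs_triangle_ineq)
      also have "\<dots> \<le> C * (b - a) * \<bar>h x\<bar> + C * (H b - H a)"
        using 1 2 C[of x] x ab \<open>0 \<le> C\<close> by (intro add_mono mult_mono) auto
      finally show "\<bar>h x * z b + \<psi> a * z' x - F x\<bar> \<le> C * (b - a) * \<bar>h x\<bar> + C * (H b - H a)" .
    qed
    also have "\<dots> = C * (b - a) * (H b - H a) + C * (H b - H a) * (b - a)"
      using sub[OF ai, of a b] split[OF ai, of a b] ab
      by (subst integral_add) (auto simp: H_def intro!: integrable_on_mult_right)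
    finally show ?thesis
      by (simp add: algebra_simps)
  qed
  have "(D has_real_derivative 0) (at x within {0..1})" if x: "x \<in> {0..1}" for x
    unfolding has_field_derivative_iff
  proof (rule Lim_null_comparison)
    have "norm ((D y - D x) / (y - x)) \<le> 2 * C * \<bar>H y - H x\<bar>" if "y \<in> {0..1}" "y \<noteq> x" for y
    proof -
      have "\<bar>D y - D x\<bar> \<le> 2 * C * \<bar>y - x\<bar> * \<bar>H y - H x\<bar>"
      proof (cases "x \<le> y")
        case True
        have "\<bar>D y - D x\<bar> \<le> 2 * C * (y - x) * (H y - H x)"
          using increment[of x y] x that True by simp
        also have "\<dots> \<le> 2 * C * (y - x) * \<bar>H y - H x\<bar>"
          using True \<open>0 \<le> C\<close> by (intro mult_left_mono) auto
        finally show ?thesis using True by simp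
      next
        case False
        have "\<bar>D y - D x\<bar> \<le> 2 * C * (x - y) * (H x - H y)"
          using increment[of y x] x that False by simp
        also have "\<dots> \<le> 2 * C * (x - y) * \<bar>H y - H x\<bar>"
          using False \<open>0 \<le> C\<close> by (intro mult_left_mono) auto
        finally show ?thesis using False by simp
      qed
      then show ?thesis
        using that by (simp add: field_simps)
    qed
    then show "\<forall>\<^sub>F y in at x within {0..1}. norm ((D y - D x) / (y - x)) \<le> 2 * C * \<bar>H y - H x\<bar>"
      by (auto simp: eventually_at_filter)
    have "(H \<longlongrightarrow> H x) (at x within {0..1})"
      using H_cont x by (simp add: continuous_on_def)
    then have "((\<lambda>y. 2 * C * \<bar>H y - H x\<bar>) \<longlongrightarrow> 2 * C * \<bar>H x - H x\<bar>) (at x within {0..1})"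
      by (intro tendsto_mult tendsto_const tendsto_rabs tendsto_diff)
    then show "((\<lambda>y. 2 * C * \<bar>H y - H x\<bar>) \<longlongrightarrow> 0) (at x within {0..1})"
      by simp
  qed
  then obtain c where "\<And>x. x \<in> {0..1} \<Longrightarrow> D x = c"
    using has_field_derivative_zero_constant[of "{0..1}" D] by auto
  then have "D 1 = D 0"
    by simp
  moreover have "integral {0..1} F = integral {0..1} (\<lambda>x. h x * z x) + integral {0..1} (\<lambda>x. \<psi> x * z' x)"
    unfolding F_def by (intro integral_add hz \<psi>z' z_cont)
  ultimately show ?thesis
    by (simp add: D_def)
qed

lemma energy_identity:
  assumes y: "second_deriv y \<psi> h" "L2 h" and z: "second_deriv z \<eta> k" "L2 k" "z 0 = 0" "z 1 = 0"
  shows "integral {0..1} (\<lambda>x. h x * z x) = - integral {0..1} (\<lambda>x. \<psi> x * \<eta> x)"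
proof -
  have "integral {0..1} (\<lambda>x. h x * z x) + integral {0..1} (\<lambda>x. \<psi> x * \<eta> x) = \<psi> 1 * z 1 - \<psi> 0 * z 0"
    by (rule integration_by_parts_absolutely_continuous[OF L2_absolutely_integrable[OF y(2)] second_derivD(2)[OF y(1)]
          second_derivD(1)[OF z(1)] second_deriv_continuous_deriv[OF z(1) L2_integrable[OF z(2)]]])
  then show ?thesis
    using z by simp
qed

lemma green_identity:
  assumes "second_deriv y \<psi> h" "L2 h" "y 0 = 0" "y 1 = 0" and "second_deriv z \<eta> k" "L2 k" "z 0 = 0" "z 1 = 0"
  shows "integral {0..1} (\<lambda>x. h x * z x) = integral {0..1} (\<lambda>x. y x * k x)"
  using energy_identity[of y \<psi> h z \<eta> k] energy_identity[of z \<eta> k y \<psi> h] assms by (simp add: mult.commute)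

section \<open>Volterra equations\<close>

text \<open>The bound is required at every point of the interval rather than almost everywhere, so
  that estimates under the integral are pointwise; essentially bounded potentials are first changed
  on a null set.\<close>

locale bounded_measurable =
  fixes p :: "real \<Rightarrow> real" and C :: real
  assumes measurable: "p \<in> borel_measurable (lebesgue_on {0..1})"
    and bound: "x \<in> {0..1} \<Longrightarrow> \<bar>p x\<bar> \<le> C"
begin

lemma bound_nonneg: "0 \<le> C"
  using bound[of 0] by simp

lemma L2_mult: "L2 f \<Longrightarrow> L2 (\<lambda>x. p x * f x)"
  by (rule L2_mult_bounded[OF _ measurable bound])

lemma mult_continuous_integrable: "continuous_on {0..1} w \<Longrightarrow> (\<lambda>x. p x * w x) integrable_on {0..1}"
  by (rule L2_integrable[OF L2_mult[OF L2_continuous]])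

text \<open>In the norm weighted by exp (-M x) the Volterra operator is a contraction.\<close>

lemma volterra_contraction:
  assumes "M > 0" "2 * C \<le> M\<^sup>2" "continuous_on {0..1} w"
    and w: "\<And>x. x \<in> {0..1} \<Longrightarrow> \<bar>w x\<bar> \<le> d * exp (M * x)" and x: "x \<in> {0..1}"
  shows "\<bar>double_integral (\<lambda>s. p s * w s) x\<bar> \<le> d / 2 * exp (M * x)"
proof -
  have "0 \<le> d"
    using w[of 0] by simp
  have exp_int: "((\<lambda>r. c * exp (M * r)) has_integral c / M * (exp (M * s) - 1)) {0..s}" if "s \<ge> 0" for c s
  proof -
    have "((\<lambda>r. c * exp (M * r)) has_integral c / M * exp (M * s) - c / M * exp (M * 0)) {0..s}"
      using that \<open>M > 0\<close>
      by (intro fundamental_theorem_of_calculus)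
        (auto intro!: derivative_eq_intros simp: has_real_derivative_iff_has_vector_derivative[symmetric])
    then show ?thesis
      by (simp add: algebra_simps)
  qed
  have pw: "(\<lambda>s. p s * w s) integrable_on {0..1}"
    by (rule mult_continuous_integrable) fact
  have inner: "\<bar>integral {0..s} (\<lambda>s. p s * w s)\<bar> \<le> C * d / M * exp (M * s)" if s: "s \<in> {0..1}" for s
  proof -
    have ei: "((\<lambda>r. C * d * exp (M * r)) has_integral C * d / M * (exp (M * s) - 1)) {0..s}"
      using exp_int[of s] s by simp
    have "\<bar>integral {0..s} (\<lambda>s. p s * w s)\<bar> \<le> integral {0..s} (\<lambda>r. C * d * exp (M * r))"
    proof (rule abs_integral_le)
      fix r assume "r \<in> {0..s}"
      then have "r \<in> {0..1}" using s by auto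
      then have "\<bar>p r\<bar> * \<bar>w r\<bar> \<le> C * (d * exp (M * r))"
        by (intro mult_mono bound w bound_nonneg) auto
      then show "\<bar>p r * w r\<bar> \<le> C * d * exp (M * r)"
        by (simp add: abs_mult mult.assoc)
    qed (use ei in \<open>auto intro: has_integral_integrable integrable_on_initial_interval[OF pw s]\<close>)
    also have "\<dots> = C * d / M * (exp (M * s) - 1)"
      by (rule integral_unique[OF ei])
    also have "\<dots> \<le> C * d / M * exp (M * s)"
      using bound_nonneg \<open>0 \<le> d\<close> \<open>M > 0\<close> by (intro mult_left_mono) auto
    finally show ?thesis .
  qed
  have ei: "((\<lambda>r. C * d / M * exp (M * r)) has_integral C * d / M / M * (exp (M * x) - 1)) {0..x}"
    by (rule exp_int) (use x in simp)
  have "\<bar>double_integral (\<lambda>s. p s * w s) x\<bar> \<le> integral {0..x} (\<lambda>r. C * d / M * exp (M * r))"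
    unfolding double_integral_def
  proof (rule abs_integral_le)
    show "(\<lambda>s. integral {0..s} (\<lambda>s. p s * w s)) integrable_on {0..x}"
      by (rule integrable_on_initial_interval[OF integrable_continuous_interval[OF continuous_on_initial_integral[OF pw]] x])
    show "(\<lambda>r. C * d / M * exp (M * r)) integrable_on {0..x}"
      using ei by (rule has_integral_integrable)
    show "\<bar>integral {0..s} (\<lambda>s. p s * w s)\<bar> \<le> C * d / M * exp (M * s)" if "s \<in> {0..x}" for s
      using that x by (intro inner) auto
  qed
  also have "\<dots> = C * d / M / M * (exp (M * x) - 1)"
    by (rule integral_unique[OF ei])
  also have "\<dots> \<le> d / 2 * exp (M * x)"
  proof (rule mult_mono)
    have "2 * C * d \<le> M\<^sup>2 * d"
      using assms(2) \<open>0 \<le> d\<close> by (rule mult_right_mono)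
    then show "C * d / M / M \<le> d / 2"
      using \<open>M > 0\<close> by (simp add: field_simps power2_eq_square)
  qed (use \<open>0 \<le> d\<close> \<open>M > 0\<close> x in auto)
  finally show ?thesis .
qed

text \<open>Any positive number whose square is at least \<open>2 * C\<close> makes the Volterra
  operator halve the weighted norm; this choice avoids a square root and is positive even for
  \<open>C = 0\<close>.\<close>

definition weight :: real where "weight = 1 + 2 * C"

lemma weight: "weight > 0" "2 * C \<le> weight\<^sup>2"
  using bound_nonneg by (auto simp: weight_def power2_eq_square algebra_simps)

lemma volterra_bound:
  assumes "continuous_on {0..1} w" "\<And>x. x \<in> {0..1} \<Longrightarrow> \<bar>w x\<bar> \<le> d * exp (weight * x)" "x \<in> {0..1}"
  shows "\<bar>double_integral (\<lambda>s. p s * w s) x\<bar> \<le> d / 2 * exp (weight * x)"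
  by (rule volterra_contraction[OF weight assms])

text \<open>A solution equals its image under the Volterra operator, so its weighted bound can be
  halved arbitrarily often.\<close>

lemma volterra_unique:
  assumes z: "continuous_on {0..1} z" "\<And>x. x \<in> {0..1} \<Longrightarrow> z x = double_integral (\<lambda>s. p s * z s) x"
    and x: "x \<in> {0..1}"
  shows "z x = 0"
proof -
  obtain d where d: "\<And>x. x \<in> {0..1} \<Longrightarrow> \<bar>z x\<bar> \<le> d"
    using compact_continuous_image[OF z(1) compact_Icc, THEN compact_imp_bounded] unfolding bounded_iff by fastforce
  have "0 \<le> d"
    using d[of 0] by simp
  have iter: "\<bar>z x\<bar> \<le> d / 2 ^ k * exp (weight * x)" if "x \<in> {0..1}" for k x
    using that
  proof (induction k arbitrary: x)
    case 0
    have "\<bar>z x\<bar> \<le> d * 1"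
      using d 0 by simp
    also have "\<dots> \<le> d * exp (weight * x)"
      using \<open>0 \<le> d\<close> 0 weight(1) by (intro mult_left_mono) auto
    finally show ?case by simp
  next
    case (Suc k)
    have "\<bar>double_integral (\<lambda>s. p s * z s) x\<bar> \<le> d / 2 ^ k / 2 * exp (weight * x)"
      by (rule volterra_bound[OF z(1) Suc.IH Suc.prems])
    then show ?case
      using z(2)[OF Suc.prems] by (simp add: field_simps)
  qed
  have "(\<lambda>k. d * exp (weight * x) * (1 / 2) ^ k) \<longlonglongrightarrow> d * exp (weight * x) * 0"
    by (intro tendsto_mult tendsto_const LIMSEQ_realpow_zero) auto
  then have "\<bar>z x\<bar> \<le> d * exp (weight * x) * 0"
    by (rule LIMSEQ_le_const) (use iter[OF x] in \<open>auto simp: power_divide field_simps\<close>)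
  then show ?thesis
    by simp
qed

primrec picard :: "(real \<Rightarrow> real) \<Rightarrow> nat \<Rightarrow> real \<Rightarrow> real" where
  "picard g 0 = g"
| "picard g (Suc k) = (\<lambda>x. g x + double_integral (\<lambda>s. p s * picard g k s) x)"

lemma picard_continuous: "continuous_on {0..1} g \<Longrightarrow> continuous_on {0..1} (picard g k)"
  by (induction k)
    (simp_all add: continuous_on_add double_integral_continuous[OF mult_continuous_integrable])

lemma double_integral_mult_diff:
  assumes "continuous_on {0..1} v" "continuous_on {0..1} w" "x \<in> {0..1}"
  shows "double_integral (\<lambda>s. p s * v s) x - double_integral (\<lambda>s. p s * w s) x
    = double_integral (\<lambda>s. p s * (v s - w s)) x"
  unfolding right_diff_distrib
  by (rule double_integral_diff[symmetric]) (intro mult_continuous_integrable assms)+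

lemma volterra_exists:
  assumes g: "continuous_on {0..1} g"
  obtains y where "continuous_on {0..1} y" "\<And>x. x \<in> {0..1} \<Longrightarrow> y x = g x + double_integral (\<lambda>s. p s * y s) x"
proof -
  define D where "D k x = picard g (Suc k) x - picard g k x" for k x
  have D_cont: "continuous_on {0..1} (D k)" for k
    unfolding D_def by (intro continuous_on_diff picard_continuous g)
  obtain d where d: "\<And>x. x \<in> {0..1} \<Longrightarrow> \<bar>D 0 x\<bar> \<le> d"
    using compact_continuous_image[OF D_cont compact_Icc, THEN compact_imp_bounded] unfolding bounded_iff by fastforce
  have "0 \<le> d"
    using d[of 0] by simp
  have D_le: "\<bar>D k x\<bar> \<le> d / 2 ^ k * exp (weight * x)" if "x \<in> {0..1}" for k x
    using that
  proof (induction k arbitrary: x)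
    case 0
    have "\<bar>D 0 x\<bar> \<le> d * 1"
      using d 0 by simp
    also have "\<dots> \<le> d * exp (weight * x)"
      using \<open>0 \<le> d\<close> 0 weight(1) by (intro mult_left_mono) auto
    finally show ?case by simp
  next
    case (Suc k)
    have "\<bar>double_integral (\<lambda>s. p s * D k s) x\<bar> \<le> d / 2 ^ k / 2 * exp (weight * x)"
      by (rule volterra_bound[OF D_cont Suc.IH Suc.prems])
    moreover have "D (Suc k) x = double_integral (\<lambda>s. p s * D k s) x"
      using double_integral_mult_diff[OF picard_continuous[OF g] picard_continuous[OF g] Suc.prems, of "Suc k" k]
      by (simp add: D_def)
    ultimately show ?case
      by (simp add: field_simps)
  qed
  \<comment> \<open>The series telescopes to the limit of the Picard iterates; as its terms are
    dominated by a geometric series, the convergence is uniform.\<close>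
  define y where "y x = g x + (\<Sum>k. D k x)" for x
  have "uniform_limit {0..1} (\<lambda>n x. \<Sum>k<n. D k x) (\<lambda>x. \<Sum>k. D k x) sequentially"
  proof (rule Weierstrass_m_test)
    show "norm (D k x) \<le> d * exp weight * (1 / 2) ^ k" if "x \<in> {0..1}" for k x
    proof -
      have "\<bar>D k x\<bar> \<le> d / 2 ^ k * exp (weight * x)"
        by (rule D_le[OF that])
      also have "\<dots> \<le> d / 2 ^ k * exp weight"
        using that \<open>0 \<le> d\<close> weight(1) by (intro mult_left_mono) auto
      finally show ?thesis
        by (simp add: power_divide field_simps)
    qed
  qed (auto intro!: summable_mult summable_geometric)
  then have "uniform_limit {0..1} (\<lambda>n x. g x + (\<Sum>k<n. D k x)) y sequentially"
    unfolding y_def by (intro uniform_limit_add uniform_limit_const)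
  moreover have "g x + (\<Sum>k<n. D k x) = picard g n x" for n x
    unfolding D_def by (subst sum_lessThan_telescope) simp
  ultimately have lim: "uniform_limit {0..1} (picard g) y sequentially"
    by simp
  have y_cont: "continuous_on {0..1} y"
    by (rule uniform_limit_theorem[OF _ lim]) (auto intro!: always_eventually picard_continuous g)
  show thesis
  proof (rule that[OF y_cont])
    fix x :: real assume x: "x \<in> {0..1}"
    have "(\<lambda>n. double_integral (\<lambda>s. p s * picard g n s) x - double_integral (\<lambda>s. p s * y s) x) \<longlonglongrightarrow> 0"
    proof (rule LIMSEQ_I)
      fix \<epsilon> :: real assume "\<epsilon> > 0"
      define \<delta> where "\<delta> = \<epsilon> / exp (weight * x)"
      have "\<delta> > 0"
        using \<open>\<epsilon> > 0\<close> by (simp add: \<delta>_def)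
      then obtain N where N: "\<And>n s. n \<ge> N \<Longrightarrow> s \<in> {0..1} \<Longrightarrow> \<bar>picard g n s - y s\<bar> < \<delta>"
        using uniform_limitD[OF lim \<open>\<delta> > 0\<close>] unfolding eventually_sequentially dist_real_def by blast
      have "\<bar>double_integral (\<lambda>s. p s * picard g n s) x - double_integral (\<lambda>s. p s * y s) x\<bar> < \<epsilon>" if "n \<ge> N" for n
      proof -
        have "\<bar>picard g n s - y s\<bar> \<le> \<delta> * exp (weight * s)" if "s \<in> {0..1}" for s
        proof -
          have "\<bar>picard g n s - y s\<bar> \<le> \<delta> * 1"
            using N[OF \<open>n \<ge> N\<close> that] by simp
          also have "\<dots> \<le> \<delta> * exp (weight * s)"
            using \<open>\<delta> > 0\<close> that weight(1) by (intro mult_left_mono) auto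
          finally show ?thesis .
        qed
        then have "\<bar>double_integral (\<lambda>s. p s * (picard g n s - y s)) x\<bar> \<le> \<delta> / 2 * exp (weight * x)"
          by (intro volterra_bound x continuous_on_diff picard_continuous g y_cont)
        also have "\<dots> < \<epsilon>"
          using \<open>\<epsilon> > 0\<close> by (simp add: \<delta>_def)
        finally show ?thesis
          by (simp add: double_integral_mult_diff[OF picard_continuous[OF g] y_cont x])
      qed
      then show "\<exists>N. \<forall>n\<ge>N. norm (double_integral (\<lambda>s. p s * picard g n s) x - double_integral (\<lambda>s. p s * y s) x - 0) < \<epsilon>"
        by auto
    qed
    then have "(\<lambda>n. double_integral (\<lambda>s. p s * picard g n s) x) \<longlonglongrightarrow> double_integral (\<lambda>s. p s * y s) x"
      by (rule LIM_zero_cancel)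
    then have "(\<lambda>n. picard g (Suc n) x) \<longlonglongrightarrow> g x + double_integral (\<lambda>s. p s * y s) x"
      by (simp add: tendsto_add)
    moreover have "(\<lambda>n. picard g (Suc n) x) \<longlonglongrightarrow> y x"
      using tendsto_uniform_limitI[OF lim x] by (rule LIMSEQ_Suc)
    ultimately show "y x = g x + double_integral (\<lambda>s. p s * y s) x"
      using LIMSEQ_unique by blast
  qed
qed

text \<open>Two integrations of \<open>y'' = p y - f\<close> with \<open>y 0 = 0\<close> and initial
  slope \<alpha> give a Volterra equation with the explicit inhomogeneity
  \<open>\<alpha> * x - double_integral f x\<close>.\<close>

lemma initial_value_problem:
  assumes f: "L2 f"
  obtains y \<psi> where "second_deriv y \<psi> (\<lambda>x. p x * y x - f x)" "y 0 = 0" "\<psi> 0 = \<alpha>"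
proof -
  note fi = L2_integrable[OF f]
  have "continuous_on {0..1} (\<lambda>x. \<alpha> * x - double_integral f x)"
    by (intro continuous_on_diff continuous_on_mult continuous_on_const continuous_on_id double_integral_continuous fi)
  then obtain y where y: "continuous_on {0..1} y"
      "\<And>x. x \<in> {0..1} \<Longrightarrow> y x = \<alpha> * x - double_integral f x + double_integral (\<lambda>s. p s * y s) x"
    using volterra_exists by blast
  note py = mult_continuous_integrable[OF y(1)]
  have hi: "(\<lambda>x. p x * y x - f x) integrable_on {0..1}"
    by (intro integrable_diff py fi)
  have y_eq: "0 + \<alpha> * x + double_integral (\<lambda>x. p x * y x - f x) x = y x" if "x \<in> {0..1}" for x
    using y(2)[OF that] double_integral_diff[OF py fi that] by simp
  show thesis
  proof (rule that)
    show "second_deriv y (\<lambda>x. \<alpha> + integral {0..x} (\<lambda>x. p x * y x - f x)) (\<lambda>x. p x * y x - f x)"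
      by (rule second_deriv_cong[OF second_deriv_double_integral[OF hi] y_eq refl])
    show "y 0 = 0"
      using y_eq[of 0] by (simp add: double_integral_def)
  qed simp
qed

lemma zero_initial_data:
  assumes y: "second_deriv y \<psi> (\<lambda>x. p x * y x)" "y 0 = 0" "\<psi> 0 = 0" and x: "x \<in> {0..1}"
  shows "y x = 0"
proof (rule volterra_unique[OF second_deriv_continuous[OF y(1)] _ x])
  fix x :: real assume "x \<in> {0..1}"
  then show "y x = double_integral (\<lambda>s. p s * y s) x"
    using second_deriv_eq_double_integral[OF y(1) mult_continuous_integrable[OF second_deriv_continuous[OF y(1)]]] y(2,3)
    by simp
qed

end

section \<open>The resolvent of a Sturm-Liouville operator\<close>

lemma norm_zero_continuous:
  assumes "continuous_on {0..1} f" "norm (abs_l2 f) = 0" "x \<in> {0..1}"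
  shows "f x = 0"
proof -
  have "integral {0..1} (\<lambda>x. (f x)\<^sup>2) = 0"
    using norm_abs_l2_square[OF L2_continuous[OF assms(1)]] assms(2) by simp
  moreover have "continuous_on {0..1} (\<lambda>x. (f x)\<^sup>2)"
    using assms(1) by (rule continuous_on_power)
  ultimately have "(f x)\<^sup>2 = 0"
    using integral_cbox_eq_0_iff[of 0 1 "\<lambda>x. (f x)\<^sup>2"] assms(3) by simp
  then show ?thesis
    by simp
qed

text \<open>Cauchy-Schwarz for the derivative against the indicator function of
  \<open>{a..b}\<close>. The resulting Hoelder estimate with exponent 1/2 provides the
  equicontinuity for Arzela-Ascoli.\<close>

lemma deriv_increment_le:
  assumes y: "\<And>x. x \<in> {0..1} \<Longrightarrow> (y has_real_derivative \<psi> x) (at x within {0..1})"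
    and \<psi>: "continuous_on {0..1} \<psi>" and ab: "0 \<le> a" "a \<le> b" "b \<le> 1"
  shows "\<bar>y b - y a\<bar> \<le> sqrt (b - a) * norm (abs_l2 \<psi>)"
proof -
  define I :: "real \<Rightarrow> real" where "I x = (if x \<in> {a..b} then 1 else 0)" for x
  have sub: "{0..1} \<inter> {a..b} = {a..b}"
    using ab by auto
  have I_int: "integral {0..1} (\<lambda>x. I x * f x) = integral {a..b} f" for f
  proof -
    have "(\<lambda>x. I x * f x) = (\<lambda>x. if x \<in> {a..b} then f x else 0)"
      by (auto simp: I_def)
    then show ?thesis
      using integral_restrict_Int[of "{0..1}" "{a..b}" f] unfolding sub by (simp only: Int_commute[of "{a..b}"] sub)
  qed
  have I: "L2 I"
    unfolding L2_def
  proof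
    have "I = indicat_real {a..b}"
      by (auto simp: I_def indicator_def)
    then show "I \<in> borel_measurable (lebesgue_on {0..1})"
      by (simp add: measurable_restrict_space1 borel_measurable_indicator)
    have "(\<lambda>x. (I x)\<^sup>2) = (\<lambda>x. if x \<in> {a..b} then 1 else 0)"
      by (auto simp: I_def)
    then show "(\<lambda>x. (I x)\<^sup>2) integrable_on {0..1}"
      using integrable_restrict_Int[of "{a..b}" "\<lambda>x. 1::real" "{0..1}"] integrable_const_ivl[of 1 a b]
      unfolding Int_commute[of "{a..b}"] sub by (simp only:)
  qed
  have "(\<psi> has_integral y b - y a) {a..b}"
  proof (rule fundamental_theorem_of_calculus[OF ab(2)])
    fix u assume u: "u \<in> {a..b}"
    then have "(y has_vector_derivative \<psi> u) (at u within {0..1})"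
      using y[of u] ab by (simp add: has_real_derivative_iff_has_vector_derivative)
    then show "(y has_vector_derivative \<psi> u) (at u within {a..b})"
      by (rule has_vector_derivative_within_subset) (use ab in auto)
  qed
  then have "y b - y a = abs_l2 I \<bullet> abs_l2 \<psi>"
    using I_int[of \<psi>] by (simp add: inner_abs_l2 I L2_continuous \<psi> integral_unique)
  moreover have "norm (abs_l2 I) = sqrt (b - a)"
  proof -
    have "integral {a..b} I = integral {a..b} (\<lambda>x. 1)"
      by (rule Henstock_Kurzweil_Integration.integral_cong) (simp add: I_def)
    then show ?thesis
      unfolding norm_eq_sqrt_inner inner_abs_l2[OF I I] I_int using ab by simp
  qed
  ultimately show ?thesis
    using Cauchy_Schwarz_ineq2[of "abs_l2 I" "abs_l2 \<psi>"] by simp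
qed

locale sturm_liouville = bounded_measurable
begin

text \<open>Adding \<open>C + 1\<close> pushes the potential up to at least 1; the operator becomes
  coercive and its inverse has norm at most 1.\<close>

definition shifted :: "real \<Rightarrow> real" where "shifted x = p x + (C + 1)"

lemma shifted_ge: "x \<in> {0..1} \<Longrightarrow> 1 \<le> shifted x"
  using bound[of x] by (simp add: shifted_def)

sublocale shifted: bounded_measurable shifted "2 * C + 1"
proof
  show "shifted \<in> borel_measurable (lebesgue_on {0..1})"
    unfolding shifted_def using measurable by simp
  show "\<bar>shifted x\<bar> \<le> 2 * C + 1" if "x \<in> {0..1}" for x
    using bound[OF that] by (simp add: shifted_def)
qed

definition bvp :: "(real \<Rightarrow> real) \<Rightarrow> (real \<Rightarrow> real) \<Rightarrow> bool" where
  "bvp f y \<longleftrightarrow> y 0 = 0 \<and> y 1 = 0 \<and> (\<exists>\<psi>. second_deriv y \<psi> (\<lambda>x. shifted x * y x - f x))"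

lemma bvp_continuous: "bvp f y \<Longrightarrow> continuous_on {0..1} y"
  unfolding bvp_def using second_deriv_continuous by blast

lemma bvp_rhs_L2: "continuous_on {0..1} y \<Longrightarrow> L2 f \<Longrightarrow> L2 (\<lambda>x. shifted x * y x - f x)"
  by (rule L2_diff[OF shifted.L2_mult[OF L2_continuous]])

text \<open>Testing the equation with \<open>y\<close> and integrating by parts gives
  \<open>\<bar>\<psi>\<bar>\<^sup>2 + \<bar>y\<bar>\<^sup>2 \<le> f \<bullet> y\<close> in the
  mean-square norms, because the shifted potential is at least 1. The bound for \<open>y\<close>
  gives uniqueness, the one for its derivative \<psi> gives compactness.\<close>

lemma bvp_energy:
  assumes y: "second_deriv y \<psi> (\<lambda>x. shifted x * y x - f x)" "y 0 = 0" "y 1 = 0" and f: "L2 f"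
  shows "norm (abs_l2 y) \<le> norm (abs_l2 f)" "norm (abs_l2 \<psi>) \<le> norm (abs_l2 f)"
proof -
  note cont = second_deriv_continuous[OF y(1)]
  note yL2 = L2_continuous[OF cont]
  note hL2 = bvp_rhs_L2[OF cont f]
  note \<psi>L2 = L2_continuous[OF second_deriv_continuous_deriv[OF y(1) L2_integrable[OF hL2]]]
  have "integral {0..1} (\<lambda>x. (shifted x * y x - f x) * y x) = - (norm (abs_l2 \<psi>))\<^sup>2"
    unfolding norm_abs_l2_square[OF \<psi>L2] unfolding power2_eq_square by (rule energy_identity[OF y(1) hL2 y(1) hL2 y(2,3)])
  moreover have "integral {0..1} (\<lambda>x. (shifted x * y x - f x) * y x)
      = integral {0..1} (\<lambda>x. shifted x * y x * y x) - abs_l2 f \<bullet> abs_l2 y"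
    unfolding inner_abs_l2[OF f yL2] left_diff_distrib
    by (intro Henstock_Kurzweil_Integration.integral_diff L2_mult_integrable shifted.L2_mult yL2 f)
  moreover have "(norm (abs_l2 y))\<^sup>2 \<le> integral {0..1} (\<lambda>x. shifted x * y x * y x)"
    unfolding norm_abs_l2_square[OF yL2]
  proof (rule integral_le[OF L2_square_integrable[OF yL2] L2_mult_integrable[OF shifted.L2_mult[OF yL2] yL2]])
    fix x :: real assume "x \<in> {0..1}"
    then show "(y x)\<^sup>2 \<le> shifted x * y x * y x"
      using mult_right_mono[OF shifted_ge[of x], of "(y x)\<^sup>2"] by (simp add: power2_eq_square mult.assoc)
  qed
  moreover have "abs_l2 f \<bullet> abs_l2 y \<le> norm (abs_l2 f) * norm (abs_l2 y)"
    by (rule norm_cauchy_schwarz)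
  ultimately have *: "(norm (abs_l2 \<psi>))\<^sup>2 + (norm (abs_l2 y))\<^sup>2 \<le> norm (abs_l2 f) * norm (abs_l2 y)"
    by linarith
  then have "norm (abs_l2 y) * norm (abs_l2 y) \<le> norm (abs_l2 f) * norm (abs_l2 y)"
    using zero_le_power2[of "norm (abs_l2 \<psi>)"] unfolding power2_eq_square[of "norm (abs_l2 y)"] by linarith
  then show le: "norm (abs_l2 y) \<le> norm (abs_l2 f)"
    by (cases "norm (abs_l2 y) = 0") (use norm_ge_zero[of "abs_l2 f"] in auto)
  have "(norm (abs_l2 \<psi>))\<^sup>2 \<le> norm (abs_l2 f) * norm (abs_l2 y)"
    using * zero_le_power2[of "norm (abs_l2 y)"] by linarith
  also have "\<dots> \<le> (norm (abs_l2 f))\<^sup>2"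
    unfolding power2_eq_square by (intro mult_left_mono le norm_ge_zero)
  finally show "norm (abs_l2 \<psi>) \<le> norm (abs_l2 f)"
    by (rule power2_le_imp_le) simp
qed

lemma bvp_lincomb:
  assumes "bvp f y" "bvp g z" "L2 f" "L2 g"
  shows "bvp (\<lambda>x. f x + c * g x) (\<lambda>x. y x + c * z x)"
proof -
  obtain \<psi> \<eta> where y: "second_deriv y \<psi> (\<lambda>x. shifted x * y x - f x)"
      and z: "second_deriv z \<eta> (\<lambda>x. shifted x * z x - g x)"
    using assms unfolding bvp_def by blast
  have "second_deriv (\<lambda>x. y x + c * z x) (\<lambda>x. \<psi> x + c * \<eta> x)
      (\<lambda>x. (shifted x * y x - f x) + c * (shifted x * z x - g x))"
    by (intro second_deriv_add y second_deriv_cmult z integrable_on_mult_right L2_integrable bvp_rhs_L2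
        bvp_continuous[OF assms(1)] bvp_continuous[OF assms(2)] assms)
  then have "second_deriv (\<lambda>x. y x + c * z x) (\<lambda>x. \<psi> x + c * \<eta> x)
      (\<lambda>x. shifted x * (y x + c * z x) - (f x + c * g x))"
    by (rule second_deriv_cong) (auto simp: algebra_simps)
  then show ?thesis
    using assms unfolding bvp_def by auto
qed

text \<open>Shooting: a solution \<open>y\<close> with initial slope 0 is corrected by a multiple of
  the homogeneous solution \<open>z\<close> with initial slope 1. The correction is possible since
  \<open>z 1 = 0\<close> would, by the energy estimate with zero data, force the slope of
  \<open>z\<close> to vanish identically.\<close>

lemma bvp_exists:
  assumes f: "L2 f"
  obtains y where "bvp f y"
proof -
  have zero: "L2 (\<lambda>x. 0)"
    by (simp add: L2_continuous)
  obtain y \<psi> where y: "second_deriv y \<psi> (\<lambda>x. shifted x * y x - f x)" "y 0 = 0"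
    using shifted.initial_value_problem[OF f, of 0] by blast
  obtain z \<eta> where z: "second_deriv z \<eta> (\<lambda>x. shifted x * z x - 0)" "z 0 = 0" "\<eta> 0 = 1"
    using shifted.initial_value_problem[OF zero, of 1] by blast
  have "z 1 \<noteq> 0"
  proof
    assume "z 1 = 0"
    then have "norm (abs_l2 \<eta>) \<le> norm (abs_l2 (\<lambda>x. 0))"
      using bvp_energy(2)[OF z(1,2) _ zero] by simp
    moreover have "continuous_on {0..1} \<eta>"
      using second_deriv_continuous_deriv[OF z(1)] L2_integrable[OF bvp_rhs_L2[OF second_deriv_continuous[OF z(1)] zero]]
      by simp
    ultimately show False
      using norm_zero_continuous[of \<eta> 0] z(3) unfolding zero_l2_def[symmetric] by simp
  qed
  define c where "c = - y 1 / z 1"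
  have "second_deriv (\<lambda>x. y x + c * z x) (\<lambda>x. \<psi> x + c * \<eta> x)
      (\<lambda>x. (shifted x * y x - f x) + c * (shifted x * z x - 0))"
    by (intro second_deriv_add y second_deriv_cmult z integrable_on_mult_right L2_integrable bvp_rhs_L2
        second_deriv_continuous[OF y(1)] second_deriv_continuous[OF z(1)] f zero)
  then have "second_deriv (\<lambda>x. y x + c * z x) (\<lambda>x. \<psi> x + c * \<eta> x)
      (\<lambda>x. shifted x * (y x + c * z x) - f x)"
    by (rule second_deriv_cong) (auto simp: algebra_simps)
  then have "bvp f (\<lambda>x. y x + c * z x)"
    using y(2) z(2) \<open>z 1 \<noteq> 0\<close> unfolding bvp_def by (auto simp: c_def)
  then show thesis
    by (rule that)
qed

text \<open>Inverse of the Dirichlet operator with potential \<open>shifted\<close>. It acts on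
  classes, while \<open>bvp\<close> speaks of functions, so a representative and a solution are
  chosen; \<open>resolvent_eq\<close> shows that the choice is immaterial.\<close>

definition resolvent :: "l2 \<Rightarrow> l2" where
  "resolvent F = (SOME Y. \<exists>f y. L2 f \<and> F = abs_l2 f \<and> bvp f y \<and> Y = abs_l2 y)"

lemma bvp_norm_le: "bvp f y \<Longrightarrow> L2 f \<Longrightarrow> norm (abs_l2 y) \<le> norm (abs_l2 f)"
  unfolding bvp_def using bvp_energy(1) by blast

lemma bvp_increment_le:
  assumes "bvp f y" "L2 f" "a \<in> {0..1}" "b \<in> {0..1}"
  shows "\<bar>y b - y a\<bar> \<le> sqrt \<bar>b - a\<bar> * norm (abs_l2 f)"
proof -
  obtain \<psi> where y: "second_deriv y \<psi> (\<lambda>x. shifted x * y x - f x)" "y 0 = 0" "y 1 = 0"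
    using assms unfolding bvp_def by blast
  have \<psi>: "continuous_on {0..1} \<psi>"
    by (rule second_deriv_continuous_deriv[OF y(1) L2_integrable[OF bvp_rhs_L2[OF second_deriv_continuous[OF y(1)] assms(2)]]])
  have le: "\<bar>y b - y a\<bar> \<le> sqrt (b - a) * norm (abs_l2 f)" if "0 \<le> a" "a \<le> b" "b \<le> 1" for a b
  proof -
    have "\<bar>y b - y a\<bar> \<le> sqrt (b - a) * norm (abs_l2 \<psi>)"
      by (rule deriv_increment_le[OF second_derivD(1)[OF y(1)] \<psi> that])
    also have "\<dots> \<le> sqrt (b - a) * norm (abs_l2 f)"
      using that by (intro mult_left_mono bvp_energy(2)[OF y assms(2)]) auto
    finally show ?thesis .
  qed
  show ?thesis
    using le[of a b] le[of b a] assms(3,4) by (cases "a \<le> b") (auto simp: abs_minus_commute)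
qed

text \<open>Differences of solutions solve the problem for the difference of the data, and the
  energy estimate bounds them by the norm of the latter, which is 0 when the data agree almost
  everywhere.\<close>

lemma resolvent_eq:
  assumes "L2 f" "bvp f y"
  shows "resolvent (abs_l2 f) = abs_l2 y"
  unfolding resolvent_def
proof (rule some_equality)
  show "\<exists>g z. L2 g \<and> abs_l2 f = abs_l2 g \<and> bvp g z \<and> abs_l2 y = abs_l2 z"
    using assms by blast
next
  fix Y assume "\<exists>g z. L2 g \<and> abs_l2 f = abs_l2 g \<and> bvp g z \<and> Y = abs_l2 z"
  then obtain g z where g: "L2 g" "abs_l2 f = abs_l2 g" "bvp g z" "Y = abs_l2 z" by blast
  note yL2 = L2_continuous[OF bvp_continuous[OF assms(2)]] and zL2 = L2_continuous[OF bvp_continuous[OF g(3)]]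
  have "bvp (\<lambda>x. f x - g x) (\<lambda>x. y x - z x)"
    using bvp_lincomb[OF assms(2) g(3) assms(1) g(1), of "-1"] by simp
  then have "norm (abs_l2 y - abs_l2 z) \<le> norm (abs_l2 f - abs_l2 g)"
    unfolding abs_l2_diff[OF yL2 zL2] abs_l2_diff[OF assms(1) g(1)]
    by (rule bvp_norm_le[OF _ L2_diff[OF assms(1) g(1)]])
  then show "Y = abs_l2 y"
    using g by simp
qed

lemma resolvent_cases:
  obtains f y where "L2 f" "F = abs_l2 f" "bvp f y" "resolvent F = abs_l2 y" "L2 y"
proof -
  obtain f where f: "F = abs_l2 f" "L2 f" by (rule abs_l2_cases)
  obtain y where y: "bvp f y" using bvp_exists[OF f(2)] .
  show thesis
    by (rule that[OF f(2,1) y _ L2_continuous[OF bvp_continuous[OF y]]]) (simp add: f resolvent_eq[OF f(2) y])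
qed

lemma resolvent_bounded_linear: "bounded_linear resolvent"
proof (rule bounded_linear_intro)
  have lincomb: "resolvent (F + c *\<^sub>R G) = resolvent F + c *\<^sub>R resolvent G" for F G c
  proof -
    obtain f y where f: "L2 f" "F = abs_l2 f" "bvp f y" "resolvent F = abs_l2 y" "L2 y" by (rule resolvent_cases)
    obtain g z where g: "L2 g" "G = abs_l2 g" "bvp g z" "resolvent G = abs_l2 z" "L2 z" by (rule resolvent_cases)
    have "resolvent (abs_l2 (\<lambda>x. f x + c * g x)) = abs_l2 (\<lambda>x. y x + c * z x)"
      by (intro resolvent_eq bvp_lincomb f g L2_add L2_cmult)
    then show ?thesis
      using f g by (simp add: abs_l2_scaleR abs_l2_add L2_cmult)
  qed
  have "resolvent 0 = 0"
    using lincomb[of 0 1 0] by simp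
  then show "resolvent (c *\<^sub>R F) = c *\<^sub>R resolvent F" for c F
    using lincomb[of 0 c F] by simp
  show "resolvent (F + G) = resolvent F + resolvent G" for F G
    using lincomb[of F 1 G] by simp
  show "norm (resolvent F) \<le> norm F * 1" for F
  proof -
    obtain f y where f: "L2 f" "F = abs_l2 f" "bvp f y" "resolvent F = abs_l2 y" "L2 y" by (rule resolvent_cases)
    then show ?thesis
      by (simp add: bvp_norm_le)
  qed
qed

text \<open>In Green's identity for the two solutions the potential terms are equal and cancel,
  leaving the two inner products.\<close>

lemma resolvent_symmetric: "resolvent F \<bullet> G = F \<bullet> resolvent G"
proof -
  obtain f y where f: "L2 f" "F = abs_l2 f" "bvp f y" "resolvent F = abs_l2 y" "L2 y" by (rule resolvent_cases)
  obtain g z where g: "L2 g" "G = abs_l2 g" "bvp g z" "resolvent G = abs_l2 z" "L2 z" by (rule resolvent_cases)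
  note fL2 = bvp_rhs_L2[OF bvp_continuous[OF f(3)] f(1)] and gL2 = bvp_rhs_L2[OF bvp_continuous[OF g(3)] g(1)]
  obtain \<psi> \<eta> where y: "second_deriv y \<psi> (\<lambda>x. shifted x * y x - f x)" "y 0 = 0" "y 1 = 0"
      and z: "second_deriv z \<eta> (\<lambda>x. shifted x * z x - g x)" "z 0 = 0" "z 1 = 0"
    using f(3) g(3) unfolding bvp_def by blast
  have "integral {0..1} (\<lambda>x. (shifted x * y x - f x) * z x) = integral {0..1} (\<lambda>x. y x * (shifted x * z x - g x))"
    by (rule green_identity[OF y(1) fL2 y(2,3) z(1) gL2 z(2,3)])
  moreover have FG: "F \<bullet> resolvent G = integral {0..1} (\<lambda>x. f x * z x)" "resolvent F \<bullet> G = integral {0..1} (\<lambda>x. y x * g x)"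
    unfolding f(4) g(4) unfolding f(2) g(2) by (intro inner_abs_l2 f g)+
  moreover have "integral {0..1} (\<lambda>x. (shifted x * y x - f x) * z x)
      = integral {0..1} (\<lambda>x. shifted x * y x * z x) - F \<bullet> resolvent G"
    unfolding FG left_diff_distrib
    by (intro Henstock_Kurzweil_Integration.integral_diff L2_mult_integrable shifted.L2_mult f g)
  moreover have "integral {0..1} (\<lambda>x. y x * (shifted x * z x - g x))
      = integral {0..1} (\<lambda>x. y x * (shifted x * z x)) - resolvent F \<bullet> G"
    unfolding FG right_diff_distrib
    by (intro Henstock_Kurzweil_Integration.integral_diff L2_mult_integrable shifted.L2_mult f g)
  moreover have "(\<lambda>x. y x * (shifted x * z x)) = (\<lambda>x. shifted x * y x * z x)"
    by (simp add: mult_ac)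
  ultimately show ?thesis
    by simp
qed

text \<open>Bounded data give solutions that vanish at 0 and share one Hoelder estimate, hence are
  uniformly bounded and equicontinuous. Arzela-Ascoli yields a uniform limit, and uniform
  convergence on the unit interval implies convergence in the mean.\<close>

lemma resolvent_compact:
  fixes X :: "nat \<Rightarrow> l2"
  assumes X: "\<And>n. norm (X n) \<le> B"
  shows "\<exists>l r. strict_mono r \<and> (\<lambda>n. resolvent (X (r n))) \<longlonglongrightarrow> l"
proof -
  have "\<exists>f y. L2 f \<and> X n = abs_l2 f \<and> bvp f y \<and> resolvent (X n) = abs_l2 y" for n
    using resolvent_cases[of "X n"] by metis
  then obtain f y where f: "\<And>n. L2 (f n)" "\<And>n. X n = abs_l2 (f n)" "\<And>n. bvp (f n) (y n)"
      "\<And>n. resolvent (X n) = abs_l2 (y n)"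
    by metis
  have "0 \<le> B"
    using X[of 0] norm_ge_zero order_trans by blast
  have inc: "\<bar>y n b - y n a\<bar> \<le> sqrt \<bar>b - a\<bar> * B" if "a \<in> {0..1}" "b \<in> {0..1}" for n a b
  proof -
    have "\<bar>y n b - y n a\<bar> \<le> sqrt \<bar>b - a\<bar> * norm (abs_l2 (f n))"
      by (rule bvp_increment_le[OF f(3,1) that])
    also have "\<dots> \<le> sqrt \<bar>b - a\<bar> * B"
      using X[of n] by (intro mult_left_mono) (auto simp: f)
    finally show ?thesis .
  qed
  have bounded: "norm (y n x) \<le> B" if x: "x \<in> {0..1}" for n x
  proof -
    have "\<bar>y n x\<bar> \<le> sqrt \<bar>x\<bar> * B"
      using inc[of 0 x n] x f(3)[of n] by (simp add: bvp_def)
    also have "\<dots> \<le> 1 * B"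
      using x \<open>0 \<le> B\<close> by (intro mult_right_mono) auto
    finally show ?thesis
      by simp
  qed
  have equicont: "\<exists>d>0. \<forall>n x'. x' \<in> {0..1} \<and> norm (x - x') < d \<longrightarrow> norm (y n x - y n x') < e"
    if x: "x \<in> {0..1}" and "0 < e" for x e :: real
  proof (intro exI conjI allI impI)
    \<comment> \<open>The square compensates the root in the Hoelder estimate; \<open>B + 1\<close>
      instead of \<open>B\<close> covers \<open>B = 0\<close>.\<close>
    show "(e / (B + 1))\<^sup>2 > 0"
      using \<open>0 < e\<close> \<open>0 \<le> B\<close> by simp
    fix n x' assume x': "x' \<in> {0..1} \<and> norm (x - x') < (e / (B + 1))\<^sup>2"
    have "sqrt \<bar>x - x'\<bar> < sqrt ((e / (B + 1))\<^sup>2)"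
      using x' by (intro real_sqrt_less_mono) simp
    also have "\<dots> = e / (B + 1)"
      using \<open>0 < e\<close> \<open>0 \<le> B\<close> by simp
    finally have "sqrt \<bar>x - x'\<bar> < e / (B + 1)" .
    then have "sqrt \<bar>x - x'\<bar> * (B + 1) < e"
      using \<open>0 \<le> B\<close> by (simp add: field_simps)
    moreover have "\<bar>y n x - y n x'\<bar> \<le> sqrt \<bar>x - x'\<bar> * B"
      using inc[of x' x n] x x' by simp
    moreover have "sqrt \<bar>x - x'\<bar> * B \<le> sqrt \<bar>x - x'\<bar> * (B + 1)"
      by (intro mult_left_mono) auto
    ultimately show "norm (y n x - y n x') < e"
      by simp
  qed
  obtain g r where g: "continuous_on {0..1} g" and r: "strict_mono (r :: nat \<Rightarrow> nat)"
      and lim: "\<And>e. 0 < e \<Longrightarrow> \<exists>N. \<forall>n x. n \<ge> N \<and> x \<in> {0..1} \<longrightarrow> norm (y (r n) x - g x) < e"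
    using Arzela_Ascoli[of "{0..1}" y B, OF compact_Icc bounded equicont] by blast
  have "(\<lambda>n. resolvent (X (r n))) \<longlonglongrightarrow> abs_l2 g"
  proof (rule LIMSEQ_I)
    fix e :: real assume "0 < e"
    then obtain N where N: "\<And>n x. n \<ge> N \<Longrightarrow> x \<in> {0..1} \<Longrightarrow> norm (y (r n) x - g x) < e / 2"
      using lim[of "e / 2"] by auto
    have "norm (resolvent (X (r n)) - abs_l2 g) < e" if "n \<ge> N" for n
    proof -
      have L2s: "L2 (y (r n))" "L2 g"
        using bvp_continuous[OF f(3)] g by (auto intro: L2_continuous)
      have "norm (abs_l2 (\<lambda>x. y (r n) x - g x)) \<le> e / 2"
        using N[OF that] \<open>0 < e\<close> by (intro norm_abs_l2_le_sup L2_diff L2s) (auto simp: less_imp_le)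
      then show ?thesis
        using \<open>0 < e\<close> by (simp add: f(4) abs_l2_diff[OF L2s])
    qed
    then show "\<exists>N. \<forall>n\<ge>N. norm (resolvent (X (r n)) - abs_l2 g) < e"
      by blast
  qed
  then show ?thesis
    using r by blast
qed

sublocale resolvent: compact_symmetric resolvent
  by (rule compact_symmetric.intro[OF resolvent_bounded_linear resolvent_symmetric resolvent_compact])

end

section \<open>Completeness of the Dirichlet eigenfunctions\<close>

lemma abs_l2_cong:
  assumes "L2 f" "L2 g" "\<And>x. x \<in> {0..1} \<Longrightarrow> f x = g x"
  shows "abs_l2 f = abs_l2 g"
  unfolding abs_l2_eq_iff[OF assms(1,2)] by (rule AE_I2) (simp add: assms(3))

text \<open>\<open>second_deriv\<close> was given exactly the shape of the inner condition in
  \<open>dir_eigenpair\<close>, so that its calculus applies to eigenfunctions.\<close>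

lemma dir_eigenpair_iff:
  "dir_eigenpair q \<mu> \<phi> \<longleftrightarrow> \<phi> 0 = 0 \<and> \<phi> 1 = 0 \<and> (\<exists>x\<in>{0..1}. \<phi> x \<noteq> 0) \<and>
     (\<exists>\<psi>. second_deriv \<phi> \<psi> (\<lambda>s. (q s - \<mu>) * \<phi> s))"
  unfolding dir_eigenpair_def second_deriv_def by (rule refl)

lemma dir_eigenpair_continuous: "dir_eigenpair q \<mu> \<phi> \<Longrightarrow> continuous_on {0..1} \<phi>"
  unfolding dir_eigenpair_iff using second_deriv_continuous by blast

lemma dir_eigenpair_L2: "dir_eigenpair q \<mu> \<phi> \<Longrightarrow> L2 \<phi>"
  by (rule L2_continuous[OF dir_eigenpair_continuous])

lemma dir_eigenpair_norm_pos:
  assumes "dir_eigenpair q \<mu> \<phi>"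
  shows "norm (abs_l2 \<phi>) > 0"
proof -
  obtain x where "x \<in> {0..1}" "\<phi> x \<noteq> 0"
    using assms unfolding dir_eigenpair_iff by blast
  then have "norm (abs_l2 \<phi>) \<noteq> 0"
    using norm_zero_continuous[OF dir_eigenpair_continuous[OF assms]] by blast
  then show ?thesis
    using norm_ge_zero[of "abs_l2 \<phi>"] by linarith
qed

lemma dir_eigenpair_cong_AE:
  assumes "AE x in lebesgue_on {0..1}. q x = q' x" "dir_eigenpair q \<mu> \<phi>"
  shows "dir_eigenpair q' \<mu> \<phi>"
proof -
  have "AE x in lebesgue_on {0..1}. (q x - \<mu>) * \<phi> x = (q' x - \<mu>) * \<phi> x"
    using assms(1) by eventually_elim simp
  then show ?thesis
    using assms(2) unfolding dir_eigenpair_iff by (blast intro: second_deriv_cong_AE)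
qed

text \<open>The potential enters an eigenpair only under an integral. Replacing it by an everywhere
  bounded version therefore leaves the given spectral data valid.\<close>

lemma dir_spectrum_cong_AE:
  assumes "AE x in lebesgue_on {0..1}. q x = q' x" "dir_spectrum q lam \<phi>"
  shows "dir_spectrum q' lam \<phi>"
proof -
  have "AE x in lebesgue_on {0..1}. q' x = q x"
    using assms(1) by eventually_elim simp
  then have "dir_eigenpair q = dir_eigenpair q'"
    using dir_eigenpair_cong_AE assms(1) by blast
  then show ?thesis
    using assms(2) unfolding dir_spectrum_def by simp
qed

context bounded_measurable
begin

lemma L2_eigen_rhs: "continuous_on {0..1} \<phi> \<Longrightarrow> L2 (\<lambda>s. (p s - \<mu>) * \<phi> s)"
  unfolding left_diff_distrib by (intro L2_diff L2_mult L2_cmult L2_continuous)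

text \<open>Testing the eigenvalue equation with \<phi> itself yields minus the integral of
  \<open>\<psi>\<^sup>2\<close>, which is not positive. The lower bound depends only on the bound of
  the potential, so one constant serves both the limit problem and its perturbations.\<close>

lemma eigenvalue_ge:
  assumes "dir_eigenpair p \<mu> \<phi>"
  shows "- C \<le> \<mu>"
proof -
  obtain \<psi> where \<phi>: "\<phi> 0 = 0" "\<phi> 1 = 0" "second_deriv \<phi> \<psi> (\<lambda>s. (p s - \<mu>) * \<phi> s)"
    using assms unfolding dir_eigenpair_iff by blast
  note cont = dir_eigenpair_continuous[OF assms]
  note hL2 = L2_eigen_rhs[OF cont]
  note \<phi>L2 = dir_eigenpair_L2[OF assms]
  have \<psi>: "continuous_on {0..1} \<psi>"
    by (rule second_deriv_continuous_deriv[OF \<phi>(3) L2_integrable[OF hL2]])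
  have "integral {0..1} (\<lambda>x. (- C - \<mu>) * (\<phi> x)\<^sup>2) \<le> integral {0..1} (\<lambda>x. (p x - \<mu>) * \<phi> x * \<phi> x)"
  proof (rule integral_le)
    fix x :: real assume "x \<in> {0..1}"
    then have "(- C - \<mu>) * (\<phi> x)\<^sup>2 \<le> (p x - \<mu>) * (\<phi> x)\<^sup>2"
      using bound[of x] by (intro mult_right_mono) auto
    then show "(- C - \<mu>) * (\<phi> x)\<^sup>2 \<le> (p x - \<mu>) * \<phi> x * \<phi> x"
      by (simp add: power2_eq_square mult.assoc)
  qed (intro integrable_on_mult_right L2_square_integrable \<phi>L2, intro L2_mult_integrable hL2 \<phi>L2)
  also have "\<dots> = - integral {0..1} (\<lambda>x. \<psi> x * \<psi> x)"
    by (rule energy_identity[OF \<phi>(3) hL2 \<phi>(3) hL2 \<phi>(1,2)])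
  also have "\<dots> \<le> 0"
    using \<psi> by (simp add: Henstock_Kurzweil_Integration.integral_nonneg integrable_continuous_interval continuous_on_mult)
  finally have "(- C - \<mu>) * (norm (abs_l2 \<phi>))\<^sup>2 \<le> 0"
    by (simp add: norm_abs_l2_square[OF \<phi>L2])
  then show ?thesis
    using dir_eigenpair_norm_pos[OF assms] by (simp add: mult_le_0_iff)
qed

end

text \<open>Used in two ways: with equal potentials the right side is 0 and eigenfunctions of
  distinct eigenvalues are orthogonal; with different ones it is the defect equation for \<phi> as
  an approximate eigenfunction of the other operator.\<close>

lemma eigenpair_inner:
  assumes "bounded_measurable p C" "bounded_measurable q D"
    and \<phi>: "dir_eigenpair p \<mu> \<phi>" and \<chi>: "dir_eigenpair q \<nu> \<zeta>"
  shows "(\<nu> - \<mu>) * (abs_l2 \<phi> \<bullet> abs_l2 \<zeta>) = abs_l2 (\<lambda>x. (q x - p x) * \<phi> x) \<bullet> abs_l2 \<zeta>"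
proof -
  interpret p: bounded_measurable p C by fact
  interpret q: bounded_measurable q D by fact
  obtain \<psi> where \<psi>: "\<phi> 0 = 0" "\<phi> 1 = 0" "second_deriv \<phi> \<psi> (\<lambda>s. (p s - \<mu>) * \<phi> s)"
    using \<phi> unfolding dir_eigenpair_iff by blast
  obtain \<eta> where \<eta>: "\<zeta> 0 = 0" "\<zeta> 1 = 0" "second_deriv \<zeta> \<eta> (\<lambda>s. (q s - \<nu>) * \<zeta> s)"
    using \<chi> unfolding dir_eigenpair_iff by blast
  note \<phi>L2 = dir_eigenpair_L2[OF \<phi>] and \<zeta>L2 = dir_eigenpair_L2[OF \<chi>]
  note h = p.L2_eigen_rhs[OF dir_eigenpair_continuous[OF \<phi>]] and k = q.L2_eigen_rhs[OF dir_eigenpair_continuous[OF \<chi>]]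
  have dL2: "L2 (\<lambda>x. (q x - p x) * \<phi> x)"
    unfolding left_diff_distrib by (intro L2_diff p.L2_mult q.L2_mult \<phi>L2)
  have "(\<lambda>x. (q x - p x) * \<phi> x * \<zeta> x)
      = (\<lambda>x. (\<phi> x * ((q x - \<nu>) * \<zeta> x) - (p x - \<mu>) * \<phi> x * \<zeta> x) + (\<nu> - \<mu>) * (\<phi> x * \<zeta> x))"
    by (simp add: algebra_simps)
  then have "abs_l2 (\<lambda>x. (q x - p x) * \<phi> x) \<bullet> abs_l2 \<zeta> = integral {0..1}
      (\<lambda>x. (\<phi> x * ((q x - \<nu>) * \<zeta> x) - (p x - \<mu>) * \<phi> x * \<zeta> x) + (\<nu> - \<mu>) * (\<phi> x * \<zeta> x))"
    by (simp only: inner_abs_l2[OF dL2 \<zeta>L2])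
  also have "\<dots> = (integral {0..1} (\<lambda>x. \<phi> x * ((q x - \<nu>) * \<zeta> x)) - integral {0..1} (\<lambda>x. (p x - \<mu>) * \<phi> x * \<zeta> x))
      + integral {0..1} (\<lambda>x. (\<nu> - \<mu>) * (\<phi> x * \<zeta> x))"
    by (simp only: Henstock_Kurzweil_Integration.integral_add Henstock_Kurzweil_Integration.integral_diff
        integrable_diff integrable_on_mult_right L2_mult_integrable \<phi>L2 \<zeta>L2 h k)
  also have "integral {0..1} (\<lambda>x. (p x - \<mu>) * \<phi> x * \<zeta> x) = integral {0..1} (\<lambda>x. \<phi> x * ((q x - \<nu>) * \<zeta> x))"
    by (rule green_identity[OF \<psi>(3) h \<psi>(1,2) \<eta>(3) k \<eta>(1,2)])
  finally show ?thesis
    by (simp add: inner_abs_l2[OF \<phi>L2 \<zeta>L2])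
qed

context sturm_liouville
begin

text \<open>Both functions vanish at 0, so the quotient of the initial slopes makes the difference a
  solution with zero initial data. The denominator is nonzero for the same reason: \<phi> is not
  identically 0.\<close>

lemma eigenspace_one_dimensional:
  assumes y: "dir_eigenpair p \<mu> y" and \<phi>: "dir_eigenpair p \<mu> \<phi>"
  obtains c where "\<And>x. x \<in> {0..1} \<Longrightarrow> y x = c * \<phi> x"
proof -
  interpret r: bounded_measurable "\<lambda>s. p s - \<mu>" "C + \<bar>\<mu>\<bar>"
  proof
    show "(\<lambda>s. p s - \<mu>) \<in> borel_measurable (lebesgue_on {0..1})"
      using measurable by simp
    show "\<bar>p x - \<mu>\<bar> \<le> C + \<bar>\<mu>\<bar>" if "x \<in> {0..1}" for x
      using bound[OF that] by linarith
  qed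
  obtain \<psi> where \<psi>: "y 0 = 0" "second_deriv y \<psi> (\<lambda>s. (p s - \<mu>) * y s)"
    using y unfolding dir_eigenpair_iff by blast
  obtain \<eta> where \<eta>: "\<phi> 0 = 0" "second_deriv \<phi> \<eta> (\<lambda>s. (p s - \<mu>) * \<phi> s)"
    using \<phi> unfolding dir_eigenpair_iff by blast
  have "\<eta> 0 \<noteq> 0"
    using r.zero_initial_data[OF \<eta>(2,1)] \<phi> unfolding dir_eigenpair_iff by blast
  define c where "c = \<psi> 0 / \<eta> 0"
  have "second_deriv (\<lambda>x. y x + (- c) * \<phi> x) (\<lambda>x. \<psi> x + (- c) * \<eta> x)
      (\<lambda>s. (p s - \<mu>) * y s + (- c) * ((p s - \<mu>) * \<phi> s))"
    by (intro second_deriv_add second_deriv_cmult \<psi> \<eta> integrable_on_mult_right L2_integrable L2_eigen_rhs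
        dir_eigenpair_continuous[OF y] dir_eigenpair_continuous[OF \<phi>])
  then have "second_deriv (\<lambda>x. y x + (- c) * \<phi> x) (\<lambda>x. \<psi> x + (- c) * \<eta> x)
      (\<lambda>s. (p s - \<mu>) * (y s + (- c) * \<phi> s))"
    by (rule second_deriv_cong) (auto simp: algebra_simps)
  then have "y x + (- c) * \<phi> x = 0" if "x \<in> {0..1}" for x
    by (rule r.zero_initial_data) (use that \<psi> \<eta> \<open>\<eta> 0 \<noteq> 0\<close> in \<open>auto simp: c_def\<close>)
  then show thesis
    by (intro that[of c]) (simp add: add_eq_0_iff2)
qed

lemma resolvent_eigenfunction:
  assumes "dir_eigenpair p \<mu> \<phi>"
  shows "resolvent (abs_l2 \<phi>) = (1 / (\<mu> + C + 1)) *\<^sub>R abs_l2 \<phi>"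
proof -
  have pos: "\<mu> + C + 1 > 0"
    using eigenvalue_ge[OF assms] by simp
  note \<phi>L2 = dir_eigenpair_L2[OF assms]
  obtain \<psi> where \<phi>: "\<phi> 0 = 0" "\<phi> 1 = 0" "second_deriv \<phi> \<psi> (\<lambda>s. (p s - \<mu>) * \<phi> s)"
    using assms unfolding dir_eigenpair_iff by blast
  have "second_deriv \<phi> \<psi> (\<lambda>x. shifted x * \<phi> x - (\<mu> + C + 1) * \<phi> x)"
    by (rule second_deriv_cong[OF \<phi>(3) refl]) (simp add: shifted_def algebra_simps)
  then have "bvp (\<lambda>x. (\<mu> + C + 1) * \<phi> x) \<phi>"
    using \<phi> unfolding bvp_def by blast
  then have "resolvent ((\<mu> + C + 1) *\<^sub>R abs_l2 \<phi>) = abs_l2 \<phi>"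
    unfolding abs_l2_scaleR[OF \<phi>L2] by (rule resolvent_eq[OF L2_cmult[OF \<phi>L2]])
  then have "(\<mu> + C + 1) *\<^sub>R resolvent (abs_l2 \<phi>) = abs_l2 \<phi>"
    by (simp only: linear_simps(5)[OF resolvent_bounded_linear])
  then have "(1 / (\<mu> + C + 1)) *\<^sub>R ((\<mu> + C + 1) *\<^sub>R resolvent (abs_l2 \<phi>)) = (1 / (\<mu> + C + 1)) *\<^sub>R abs_l2 \<phi>"
    by (rule arg_cong)
  then show ?thesis
    using pos by simp
qed

text \<open>The solution \<open>y\<close> behind \<open>resolvent G\<close> is a differentiable
  representative of a multiple of \<open>G\<close>, hence a genuine Dirichlet eigenfunction. Its
  eigenvalue is some \<open>lam n\<close> by the exhaustiveness clause of
  \<open>dir_spectrum\<close>, and simplicity makes it a multiple of \<open>\<phi> n\<close>, to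
  which \<open>G\<close> is orthogonal.\<close>

lemma resolvent_eigenvector_orthogonal:
  assumes spec: "dir_spectrum p lam \<phi>" and "\<kappa> \<noteq> 0" "resolvent G = \<kappa> *\<^sub>R G"
    and orth: "\<And>n. G \<bullet> abs_l2 (\<phi> n) = 0"
  shows "G = 0"
proof (rule ccontr)
  assume "G \<noteq> 0"
  obtain f y where f: "L2 f" "G = abs_l2 f" "bvp f y" "resolvent G = abs_l2 y" "L2 y" by (rule resolvent_cases)
  have y_G: "abs_l2 y = \<kappa> *\<^sub>R G"
    using f(4) assms(3) by simp
  \<comment> \<open>Almost everywhere the data \<open>f\<close> equal \<open>y / \<kappa>\<close>;
    undoing the shift \<open>C + 1\<close> then gives the eigenvalue of the unshifted
    operator.\<close>
  define \<mu> where "\<mu> = 1 / \<kappa> - (C + 1)"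
  obtain \<psi> where \<psi>: "y 0 = 0" "y 1 = 0" "second_deriv y \<psi> (\<lambda>x. shifted x * y x - f x)"
    using f(3) unfolding bvp_def by blast
  have "abs_l2 y = abs_l2 (\<lambda>x. \<kappa> * f x)"
    using y_G abs_l2_scaleR[OF f(1)] f(2) by simp
  then have "AE x in lebesgue_on {0..1}. y x = \<kappa> * f x"
    by (simp only: abs_l2_eq_iff[OF f(5) L2_cmult[OF f(1)]])
  then have "AE x in lebesgue_on {0..1}. shifted x * y x - f x = (p x - \<mu>) * y x"
    by eventually_elim (use \<open>\<kappa> \<noteq> 0\<close> in \<open>simp add: shifted_def \<mu>_def field_simps\<close>)
  then have y2: "second_deriv y \<psi> (\<lambda>x. (p x - \<mu>) * y x)"
    by (rule second_deriv_cong_AE[OF \<psi>(3)])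
  have "\<exists>x\<in>{0..1}. y x \<noteq> 0"
  proof (rule ccontr)
    assume "\<not> ?thesis"
    then have "norm (abs_l2 y) \<le> 0"
      by (intro norm_abs_l2_le_sup f) auto
    then have "abs_l2 y = 0"
      by simp
    then show False
      using y_G \<open>\<kappa> \<noteq> 0\<close> \<open>G \<noteq> 0\<close> by simp
  qed
  then have y_eig: "dir_eigenpair p \<mu> y"
    using \<psi> y2 unfolding dir_eigenpair_iff by blast
  then obtain n where n: "\<mu> = lam n"
    using spec unfolding dir_spectrum_def by blast
  then have \<phi>: "dir_eigenpair p \<mu> (\<phi> n)"
    using spec unfolding dir_spectrum_def by blast
  obtain c where "\<And>x. x \<in> {0..1} \<Longrightarrow> y x = c * \<phi> n x"
    using eigenspace_one_dimensional[OF y_eig \<phi>] by blast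
  then have "abs_l2 y = c *\<^sub>R abs_l2 (\<phi> n)"
    unfolding abs_l2_scaleR[OF dir_eigenpair_L2[OF \<phi>]]
    by (intro abs_l2_cong f L2_cmult dir_eigenpair_L2[OF \<phi>])
  then have "abs_l2 y \<bullet> abs_l2 y = (\<kappa> *\<^sub>R G) \<bullet> (c *\<^sub>R abs_l2 (\<phi> n))"
    using y_G by simp
  then have "abs_l2 y = 0"
    by (simp add: orth)
  then show False
    using y_G \<open>\<kappa> \<noteq> 0\<close> \<open>G \<noteq> 0\<close> by simp
qed

lemma eigenfunctions_orthonormal:
  assumes spec: "dir_spectrum p lam \<phi>"
  shows "orthonormal (\<lambda>n. abs_l2 (\<phi> n))"
proof
  fix m n
  have eig: "dir_eigenpair p (lam k) (\<phi> k)" "integral {0..1} (\<lambda>x. (\<phi> k x)\<^sup>2) = 1" for k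
    using spec unfolding dir_spectrum_def by auto
  show "abs_l2 (\<phi> m) \<bullet> abs_l2 (\<phi> n) = (if m = n then 1 else 0)"
  proof (cases "m = n")
    case True
    then show ?thesis
      using eig(2)[of n] by (simp add: inner_abs_l2[OF dir_eigenpair_L2[OF eig(1)] dir_eigenpair_L2[OF eig(1)]] power2_eq_square)
  next
    case False
    have "strict_mono lam"
      using spec unfolding dir_spectrum_def by blast
    then have "lam n - lam m \<noteq> 0"
      using False by (simp add: strict_mono_eq)
    moreover have "(lam n - lam m) * (abs_l2 (\<phi> m) \<bullet> abs_l2 (\<phi> n)) = 0"
      using eigenpair_inner[OF bounded_measurable_axioms bounded_measurable_axioms eig(1) eig(1), of n m]
      by (simp add: zero_l2_def[symmetric])
    ultimately show ?thesis
      using False by simp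
  qed
qed

text \<open>A function with these boundary values lies in the range of the resolvent: it is the
  image of \<open>shifted x * y x - h x\<close>.\<close>

lemma eigenfunction_expansion:
  assumes spec: "dir_spectrum p lam \<phi>"
    and y: "second_deriv y \<psi> h" "L2 h" "y 0 = 0" "y 1 = 0"
  shows "(\<lambda>N. orthonormal.proj (\<lambda>n. abs_l2 (\<phi> n)) N (abs_l2 y)) \<longlonglongrightarrow> abs_l2 y"
proof -
  have f: "L2 (\<lambda>x. shifted x * y x - h x)"
    by (rule bvp_rhs_L2[OF second_deriv_continuous[OF y(1)] y(2)])
  have "second_deriv y \<psi> (\<lambda>x. shifted x * y x - (shifted x * y x - h x))"
    using y(1) by simp
  then have "bvp (\<lambda>x. shifted x * y x - h x) y"
    using y(3,4) unfolding bvp_def by blast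
  note resolvent = resolvent_eq[OF f this]
  have eig: "resolvent (abs_l2 (\<phi> n)) = (1 / (lam n + C + 1)) *\<^sub>R abs_l2 (\<phi> n)" for n
    using spec by (intro resolvent_eigenfunction) (auto simp: dir_spectrum_def)
  show ?thesis
    using resolvent.eigenvector_expansion[where h="abs_l2 (\<lambda>x. shifted x * y x - h x)",
        OF eigenfunctions_orthonormal[OF spec] eig resolvent_eigenvector_orthogonal[OF spec]]
    unfolding resolvent .
qed

end

section \<open>Expansion of functions with arbitrary boundary values\<close>

lemma (in orthonormal) proj_tendsto_closed:
  assumes "\<And>m. (\<lambda>N. proj N (v m)) \<longlonglongrightarrow> v m" "v \<longlonglongrightarrow> x"
  shows "(\<lambda>N. proj N x) \<longlonglongrightarrow> x"
proof (rule LIMSEQ_I)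
  fix e :: real assume "0 < e"
  then obtain m where m: "norm (v m - x) < e / 2"
    using LIMSEQ_D[OF assms(2), of "e / 2"] by auto
  obtain N0 where N0: "\<And>N. N \<ge> N0 \<Longrightarrow> norm (proj N (v m) - v m) < e / 2"
    using LIMSEQ_D[OF assms(1), of "e / 2" m] \<open>0 < e\<close> by auto
  have "norm (proj N x - x) < e" if "N \<ge> N0" for N
  proof -
    \<comment> \<open>Both residuals are controlled: the one of \<open>v m\<close> is small for
      large \<open>N\<close>, and taking residuals does not increase the norm of
      \<open>x - v m\<close>, uniformly in \<open>N\<close>.\<close>
    have "proj N x - x = (proj N (v m) - v m) - ((x - v m) - proj N (x - v m)) "
      by (simp add: proj_def inner_diff_left scaleR_diff_left sum_subtractf)
    also have "norm \<dots> \<le> norm (proj N (v m) - v m) + norm (x - v m)"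
      using norm_triangle_ineq4 norm_residual_le add_left_mono order_trans by blast
    also have "\<dots> < e"
      using N0[OF that] m by (simp add: norm_minus_commute)
    finally show ?thesis .
  qed
  then show "\<exists>N0. \<forall>N\<ge>N0. norm (proj N x - x) < e"
    by blast
qed

lemma second_deriv_C2:
  assumes "\<And>x. (y has_real_derivative \<psi> x) (at x)" "\<And>x. (\<psi> has_real_derivative h x) (at x)"
  shows "second_deriv y \<psi> h"
  unfolding second_deriv_def
proof (intro conjI ballI)
  fix x :: real assume "x \<in> {0..1}"
  show "(y has_real_derivative \<psi> x) (at x within {0..1})"
    by (rule has_field_derivative_at_within[OF assms(1)])
  have "(h has_integral \<psi> x - \<psi> 0) {0..x}"
    using \<open>x \<in> {0..1}\<close>
    by (intro fundamental_theorem_of_calculus)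
      (auto intro: has_field_derivative_at_within[OF assms(2)] simp: has_real_derivative_iff_has_vector_derivative[symmetric])
  then show "\<psi> x = \<psi> 0 + integral {0..x} h"
    by (simp add: integral_unique)
qed

lemma has_derivative_powers:
  fixes x :: real
  shows "((\<lambda>x. x ^ Suc n) has_real_derivative real (Suc n) * x ^ n) (at x within S)"
    and "((\<lambda>x. (1 - x) ^ Suc n) has_real_derivative - real (Suc n) * (1 - x) ^ n) (at x within S)"
proof -
  show "((\<lambda>x. x ^ Suc n) has_real_derivative real (Suc n) * x ^ n) (at x within S)"
    using DERIV_pow[of "Suc n" x S] by (simp only: diff_Suc_Suc diff_zero)
  have "((\<lambda>x. 1 - x) has_real_derivative - 1) (at x within S)"
    by (auto intro!: derivative_eq_intros)
  from DERIV_power[OF this, of "Suc n"]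
  show "((\<lambda>x. (1 - x) ^ Suc n) has_real_derivative - real (Suc n) * (1 - x) ^ n) (at x within S)"
    by (simp del: power_Suc of_nat_Suc)
qed

text \<open>Both squared norms are \<open>1 / (2 * m + 5)\<close>. The exponents start at 2 so that
  the second derivative is a multiple of the \<open>m\<close>-th power for every
  \<open>m\<close>.\<close>

lemma norm_power_tendsto_zero:
  "(\<lambda>m. norm (abs_l2 (\<lambda>x. x ^ Suc (Suc m)))) \<longlonglongrightarrow> 0"
  "(\<lambda>m. norm (abs_l2 (\<lambda>x. (1 - x) ^ Suc (Suc m)))) \<longlonglongrightarrow> 0"
proof -
  have lim: "(\<lambda>m. sqrt (1 / real (Suc (Suc (Suc m) * 2)))) \<longlonglongrightarrow> 0"
    by real_asymp
  have "((\<lambda>x. x ^ k) has_integral 1 ^ Suc k / real (Suc k) - 0 ^ Suc k / real (Suc k)) {0..1::real}" for k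
  proof (rule fundamental_theorem_of_calculus)
    fix x :: real
    have "((\<lambda>x. x ^ Suc k / real (Suc k)) has_real_derivative real (Suc k) * x ^ k / real (Suc k)) (at x within {0..1})"
      by (intro DERIV_cdivide has_derivative_powers)
    then show "((\<lambda>x. x ^ Suc k / real (Suc k)) has_vector_derivative x ^ k) (at x within {0..1})"
      by (simp add: has_real_derivative_iff_has_vector_derivative del: power_Suc of_nat_Suc)
  qed simp
  from integral_unique[OF this] have "norm (abs_l2 (\<lambda>x. x ^ Suc (Suc m))) = sqrt (1 / real (Suc (Suc (Suc m) * 2)))" for m
    by (subst norm_abs_l2)
      (auto intro!: L2_continuous continuous_intros simp: L2norm_def power_mult[symmetric] simp del: power_Suc)
  then show "(\<lambda>m. norm (abs_l2 (\<lambda>x. x ^ Suc (Suc m)))) \<longlonglongrightarrow> 0"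
    using lim by (simp only:)
  have "((\<lambda>x. (1 - x) ^ k) has_integral (1 - 1) ^ Suc k / - real (Suc k) - (1 - 0) ^ Suc k / - real (Suc k)) {0..1::real}" for k
  proof (rule fundamental_theorem_of_calculus)
    fix x :: real
    have "((\<lambda>x. (1 - x) ^ Suc k / - real (Suc k)) has_real_derivative - real (Suc k) * (1 - x) ^ k / - real (Suc k)) (at x within {0..1})"
      by (intro DERIV_cdivide has_derivative_powers)
    then show "((\<lambda>x. (1 - x) ^ Suc k / - real (Suc k)) has_vector_derivative (1 - x) ^ k) (at x within {0..1})"
      by (simp add: has_real_derivative_iff_has_vector_derivative del: power_Suc of_nat_Suc)
  qed simp
  then have "integral {0..1} (\<lambda>x::real. (1 - x) ^ k) = 1 / real (Suc k)" for k
    by (auto dest!: integral_unique simp del: of_nat_Suc)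
  then have "norm (abs_l2 (\<lambda>x. (1 - x) ^ Suc (Suc m))) = sqrt (1 / real (Suc (Suc (Suc m) * 2)))" for m
    by (subst norm_abs_l2)
      (auto intro!: L2_continuous continuous_intros simp: L2norm_def power_mult[symmetric] simp del: power_Suc)
  then show "(\<lambda>m. norm (abs_l2 (\<lambda>x. (1 - x) ^ Suc (Suc m)))) \<longlonglongrightarrow> 0"
    using lim by (simp only:)
qed

text \<open>A function in \<^term>\<open>H2\<close> need not vanish at the endpoints. Subtracting multiples of
  \<^term>\<open>(1 - x) ^ m\<close> and \<^term>\<open>x ^ m\<close>, which are small in the mean for large m, makes it vanish there.\<close>

lemma (in sturm_liouville) eigenfunction_expansion_H2:
  assumes spec: "dir_spectrum p lam \<phi>" and u: "H2 u"
  shows "(\<lambda>N. orthonormal.proj (\<lambda>n. abs_l2 (\<phi> n)) N (abs_l2 u)) \<longlonglongrightarrow> abs_l2 u"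
proof -
  interpret orthonormal "\<lambda>n. abs_l2 (\<phi> n)"
    by (rule eigenfunctions_orthonormal[OF spec])
  obtain g c d where g: "L2 g" and u_eq: "AE x in lebesgue_on {0..1}. u x = c + d * x + double_integral g x" and uL2: "L2 u"
    using u unfolding H2_def double_integral_def by blast
  define w where "w x = c + d * x + double_integral g x" for x
  have w: "second_deriv w (\<lambda>x. d + integral {0..x} g) g"
    unfolding w_def by (rule second_deriv_double_integral[OF L2_integrable[OF g]])
  note wL2 = L2_continuous[OF second_deriv_continuous[OF w]]
  have uw: "abs_l2 u = abs_l2 w"
    using u_eq unfolding abs_l2_eq_iff[OF uL2 wL2] w_def .
  \<comment> \<open>Each power is 1 at one endpoint and 0 at the other, so the two corrections
    remove \<open>w 0\<close> and \<open>w 1\<close> independently.\<close>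
  define y where "y m x = w x + (- w 0 * (1 - x) ^ Suc (Suc m) + - w 1 * x ^ Suc (Suc m))" for m x
  have cL2: "L2 (\<lambda>x. x ^ k)" "L2 (\<lambda>x. (1 - x) ^ k)" for k
    by (auto intro!: L2_continuous continuous_intros)
  have "(\<lambda>N. proj N (abs_l2 (y m))) \<longlonglongrightarrow> abs_l2 (y m)" for m
  proof -
    define b where "b = real (Suc (Suc m)) * real (Suc m)"
    have 1: "second_deriv (\<lambda>x. (1 - x) ^ Suc (Suc m)) (\<lambda>x. - real (Suc (Suc m)) * (1 - x) ^ Suc m) (\<lambda>x. b * (1 - x) ^ m)"
    proof (rule second_deriv_C2[OF has_derivative_powers(2)])
      show "((\<lambda>x. - real (Suc (Suc m)) * (1 - x) ^ Suc m) has_real_derivative b * (1 - x) ^ m) (at x)" for x :: real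
        using DERIV_cmult[OF has_derivative_powers(2)[of m x UNIV], of "- real (Suc (Suc m))"]
        by (simp only: b_def mult.assoc mult_minus_left mult_minus_right minus_minus)
    qed
    have 2: "second_deriv (\<lambda>x. x ^ Suc (Suc m)) (\<lambda>x. real (Suc (Suc m)) * x ^ Suc m) (\<lambda>x. b * x ^ m)"
    proof (rule second_deriv_C2[OF has_derivative_powers(1)])
      show "((\<lambda>x. real (Suc (Suc m)) * x ^ Suc m) has_real_derivative b * x ^ m) (at x)" for x :: real
        using DERIV_cmult[OF has_derivative_powers(1)[of m x UNIV], of "real (Suc (Suc m))"]
        by (simp only: b_def mult.assoc)
    qed
    define h where "h x = g x + (- w 0 * (b * (1 - x) ^ m) + - w 1 * (b * x ^ m))" for x
    have 3: "L2 (\<lambda>x. - w 0 * (b * (1 - x) ^ m))" "L2 (\<lambda>x. - w 1 * (b * x ^ m))"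
      by (intro L2_cmult cL2)+
    have "\<exists>\<psi>. second_deriv (y m) \<psi> h"
      unfolding y_def h_def
      by (rule exI, rule second_deriv_add[OF w second_deriv_add[OF second_deriv_cmult[OF 1] second_deriv_cmult[OF 2]]])
        (intro L2_integrable g L2_add 3)+
    then obtain \<psi> where "second_deriv (y m) \<psi> h" ..
    then show ?thesis
    proof (rule eigenfunction_expansion[OF spec])
      show "L2 h"
        unfolding h_def by (intro L2_add g 3)
    qed (auto simp: y_def)
  qed
  moreover have "(\<lambda>m. abs_l2 (y m)) \<longlonglongrightarrow> abs_l2 w"
  proof -
    have eq: "abs_l2 (y m) = abs_l2 w + ((- w 0) *\<^sub>R abs_l2 (\<lambda>x. (1 - x) ^ Suc (Suc m)) + (- w 1) *\<^sub>R abs_l2 (\<lambda>x. x ^ Suc (Suc m)))" for m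
      unfolding abs_l2_scaleR[OF cL2(1)] abs_l2_scaleR[OF cL2(2)] abs_l2_add[OF L2_cmult[OF cL2(2)] L2_cmult[OF cL2(1)]]
        abs_l2_add[OF wL2 L2_add[OF L2_cmult[OF cL2(2)] L2_cmult[OF cL2(1)]]] y_def by (rule refl)
    have "(\<lambda>m. abs_l2 (y m)) \<longlonglongrightarrow> abs_l2 w + ((- w 0) *\<^sub>R 0 + (- w 1) *\<^sub>R 0)"
      unfolding eq
      by (intro tendsto_add tendsto_const tendsto_scaleR norm_power_tendsto_zero[THEN tendsto_norm_zero_cancel])
    then show ?thesis
      by simp
  qed
  ultimately show ?thesis
    unfolding uw by (rule proj_tendsto_closed)
qed

section \<open>Essentially bounded functions\<close>

text \<open>Clamps \<open>f\<close> to the band of half-width \<open>c\<close> around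
  \<open>g\<close>. With \<open>g = 0\<close> it realises an essential bound everywhere; with
  \<open>g\<close> a truncated potential it makes an essential distance hold everywhere, while
  preserving measurability.\<close>

definition truncate :: "(real \<Rightarrow> real) \<Rightarrow> real \<Rightarrow> (real \<Rightarrow> real) \<Rightarrow> real \<Rightarrow> real" where
  "truncate g c f x = max (g x - c) (min (g x + c) (f x))"

lemma truncate_bound: "0 \<le> c \<Longrightarrow> \<bar>truncate g c f x - g x\<bar> \<le> c"
  by (auto simp: truncate_def max_def min_def)

lemma truncate_measurable:
  assumes "g \<in> borel_measurable N" "f \<in> borel_measurable N"
  shows "truncate g c f \<in> borel_measurable N"
  unfolding truncate_def
  by (intro borel_measurable_max borel_measurable_min borel_measurable_diff borel_measurable_add
      borel_measurable_const assms)

lemma truncate_AE: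
  assumes "AE x in N. \<bar>f x - g x\<bar> \<le> c"
  shows "AE x in N. f x = truncate g c f x"
  using assms by eventually_elim (auto simp: truncate_def max_def min_def)

lemma AE_bound_of_Linf_norm_less:
  assumes "Linf_norm S f < ereal c"
  shows "AE x in lebesgue_on S. \<bar>f x\<bar> \<le> c"
  using esssup_AE[of "\<lambda>x. ereal \<bar>f x\<bar>" "lebesgue_on S"]
proof eventually_elim
  case (elim x)
  then have "ereal \<bar>f x\<bar> < ereal c"
    using assms unfolding Linf_norm_def by (rule le_less_trans)
  then show ?case
    by simp
qed

lemma LinfE:
  assumes "Linf S f"
  obtains c where "0 \<le> c" "f \<in> borel_measurable (lebesgue_on S)" "AE x in lebesgue_on S. \<bar>f x\<bar> \<le> c"
proof -
  obtain c where f: "f \<in> borel_measurable (lebesgue_on S)" "AE x in lebesgue_on S. \<bar>f x\<bar> \<le> c"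
    using assms unfolding Linf_def by blast
  have "AE x in lebesgue_on S. \<bar>f x\<bar> \<le> max c 0"
    using f(2) by eventually_elim simp
  then show thesis
    using that[of "max c 0"] f(1) by simp
qed

lemma truncated_integrable:
  assumes "0 \<le> c" "f \<in> borel_measurable (lebesgue_on {0..T})" "t \<in> {0..T}"
  shows "truncate (\<lambda>_. 0) c f integrable_on {0..t}"
proof (rule integrable_on_subinterval)
  show "truncate (\<lambda>_. 0) c f integrable_on {0..T}"
  proof (rule measurable_bounded_by_integrable_imp_integrable)
    show "truncate (\<lambda>_. 0) c f \<in> borel_measurable (lebesgue_on {0..T})"
      by (intro truncate_measurable borel_measurable_const assms)
    show "norm (truncate (\<lambda>_. 0) c f x) \<le> c" for x
      using truncate_bound[OF assms(1), of "\<lambda>_. 0" f x] by simp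
  qed (auto intro: integrable_const_ivl)
qed (use assms in auto)

lemma Linf_integrable:
  assumes "Linf {0..T} f" "t \<in> {0..T}"
  shows "f integrable_on {0..t}"
proof -
  obtain c where c: "0 \<le> c" "f \<in> borel_measurable (lebesgue_on {0..T})" "AE x in lebesgue_on {0..T}. \<bar>f x\<bar> \<le> c"
    using LinfE[OF assms(1)] .
  have "AE x in lebesgue_on {0..T}. \<bar>f x - 0\<bar> \<le> c"
    using c(3) by simp
  then have "AE x in lebesgue_on {0..T}. truncate (\<lambda>_. 0) c f x = f x"
    by (drule_tac truncate_AE) (auto elim: eventually_mono)
  then show ?thesis
    by (rule integrable_cong_AE_lebesgue_on) (use assms(2) truncated_integrable[OF c(1,2) assms(2)] in auto)
qed

lemma abs_integral_le_AE:
  fixes f :: "real \<Rightarrow> real"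
  assumes "0 \<le> c" "f \<in> borel_measurable (lebesgue_on {0..T})" "AE x in lebesgue_on {0..T}. \<bar>f x\<bar> \<le> c"
    and "t \<in> {0..T}"
  shows "\<bar>integral {0..t} f\<bar> \<le> c * t"
proof -
  have "AE x in lebesgue_on {0..T}. f x = truncate (\<lambda>_. 0) c f x"
    by (rule truncate_AE) (use assms(3) in simp)
  then have "integral {0..t} f = integral {0..t} (truncate (\<lambda>_. 0) c f)"
    by (rule integral_cong_AE_lebesgue_on) (use assms(4) in auto)
  also have "\<bar>\<dots>\<bar> \<le> integral {0..t} (\<lambda>_. c)"
  proof (rule abs_integral_le[OF truncated_integrable[OF assms(1,2,4)] integrable_const_ivl])
    show "\<bar>truncate (\<lambda>_. 0) c f x\<bar> \<le> c" for x
      using truncate_bound[OF assms(1), of "\<lambda>_. 0" f x] by simp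
  qed
  also have "\<dots> = c * t"
    using assms(4) by simp
  finally show ?thesis .
qed

section \<open>Stability of the solution\<close>

text \<open>From \<open>1 + s \<le> exp s\<close>. Only an upper bound on the exponents is required,
  which matters because \<open>- lam n * A\<close> is bounded above uniformly in \<open>n\<close>
  but not below.\<close>

lemma exp_diff_le:
  fixes x y :: real
  assumes "x \<le> B" "y \<le> B"
  shows "\<bar>exp x - exp y\<bar> \<le> exp B * \<bar>x - y\<bar>"
proof -
  have *: "exp b - exp a \<le> exp B * (b - a)" if "a \<le> b" "b \<le> B" for a b :: real
  proof -
    have "exp b * (1 + (a - b)) \<le> exp b * exp (a - b)"
      by (intro mult_left_mono exp_ge_add_one_self) simp
    then have "exp b - exp a \<le> exp b * (b - a)"
      by (simp add: exp_diff algebra_simps)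
    also have "\<dots> \<le> exp B * (b - a)"
      using that by (intro mult_right_mono) auto
    finally show ?thesis .
  qed
  show ?thesis
    using *[of x y] *[of y x] assms by (cases "x \<le> y") (auto simp: abs_if)
qed

text \<open>Partial sum of the solution operator; \<open>A\<close> stands for the integral of the
  coefficient over \<open>{0..t}\<close>, the only way in which time and the coefficient
  enter.\<close>

definition (in orthonormal) evolve :: "(nat \<Rightarrow> real) \<Rightarrow> real \<Rightarrow> nat \<Rightarrow> 'a \<Rightarrow> 'a" where
  "evolve lam A N x = (\<Sum>n<N. (exp (- lam n * A) * (x \<bullet> e n)) *\<^sub>R e n)"

context orthonormal
begin

lemma evolve_diff: "evolve lam A N (x - y) = evolve lam A N x - evolve lam A N y"
  by (simp add: evolve_def inner_diff_left algebra_simps sum_subtractf)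

lemma evolve_sum_scaleR: "evolve lam A N (\<Sum>i\<in>I. c i *\<^sub>R f i) = (\<Sum>i\<in>I. c i *\<^sub>R evolve lam A N (f i))"
proof (induction I rule: infinite_finite_induct)
  case (insert i I)
  then show ?case
    using evolve_diff[of lam A N "c i *\<^sub>R f i + (\<Sum>i\<in>I. c i *\<^sub>R f i)" "c i *\<^sub>R f i"]
    by (simp add: evolve_def scaleR_sum_right algebra_simps)
qed (simp_all add: evolve_def)

lemma evolve_proj: "N \<le> J \<Longrightarrow> evolve lam A J (proj N x) = evolve lam A N x"
  unfolding evolve_def inner_proj
  by (rule sum.mono_neutral_cong_right) auto

lemma norm_evolve_le:
  assumes "\<And>n. - M \<le> lam n" "0 \<le> M" "0 \<le> A" "A \<le> R"
  shows "norm (evolve lam A N x) \<le> exp (M * R) * norm x"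
  unfolding evolve_def
proof (rule norm_multiplier_le)
  fix n
  have "- lam n * A \<le> M * A"
    using assms(1)[of n] assms(3) by (intro mult_right_mono) auto
  also have "\<dots> \<le> M * R"
    using assms by (intro mult_left_mono) auto
  finally show "\<bar>exp (- lam n * A)\<bar> \<le> exp (M * R)"
    by simp
qed simp

text \<open>For \<open>J \<ge> N\<close> the terms between \<open>N\<close> and \<open>J\<close> are
  the evolution of the residual \<open>x - proj N x\<close>, so the uniform bound applies and
  survives the limit in \<open>J\<close>.\<close>

lemma norm_evolve_tail_le:
  assumes "\<And>n. - M \<le> lam n" "0 \<le> M" "0 \<le> A" "A \<le> R" "(\<lambda>J. evolve lam A J x) \<longlonglongrightarrow> U"
  shows "norm (U - evolve lam A N x) \<le> exp (M * R) * norm (x - proj N x)"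
proof (rule LIMSEQ_le_const2)
  show "(\<lambda>J. norm (evolve lam A J x - evolve lam A N x)) \<longlonglongrightarrow> norm (U - evolve lam A N x)"
    by (intro tendsto_norm tendsto_diff assms tendsto_const)
  have "norm (evolve lam A J x - evolve lam A N x) \<le> exp (M * R) * norm (x - proj N x)" if "J \<ge> N" for J
    using norm_evolve_le[OF assms(1-4), where N=J and x="x - proj N x"] evolve_proj[OF that] by (simp add: evolve_diff)
  then show "\<exists>N'. \<forall>J\<ge>N'. norm (evolve lam A J x - evolve lam A N x) \<le> exp (M * R) * norm (x - proj N x)"
    by blast
qed

text \<open>If \<^term>\<open>x\<close> satisfies the eigenvalue equation for \<^term>\<open>\<mu>\<close> up to the defect \<^term>\<open>g\<close>, then
  its coefficients concentrate near the eigenvalues close to \<^term>\<open>\<mu>\<close>.\<close>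

lemma norm_evolve_approximate_eigenvector:
  assumes lam: "\<And>n. - M \<le> lam n" and \<mu>: "- M \<le> \<mu>" and A: "0 \<le> M" "0 \<le> A" "A \<le> R"
    and defect: "\<And>n. (lam n - \<mu>) * (x \<bullet> e n) = g \<bullet> e n"
  shows "norm (evolve lam A N x - exp (- \<mu> * A) *\<^sub>R proj N x) \<le> R * exp (M * R) * norm g"
proof -
  \<comment> \<open>Divided difference of the exponential. At \<open>lam n = \<mu>\<close> the
    quotient is 0 by the convention for division by zero; there the difference of exponentials and
    the defect coefficient are 0 as well, so the factorisation below still holds.\<close>
  define m where "m n = (exp (- lam n * A) - exp (- \<mu> * A)) / (lam n - \<mu>)" for n
  have le_MR: "- l * A \<le> M * R" if "- M \<le> l" for l
  proof -
    have "- l * A \<le> M * A"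
      using that A by (intro mult_right_mono) auto
    also have "\<dots> \<le> M * R"
      using A by (intro mult_left_mono) auto
    finally show ?thesis .
  qed
  have m_le: "\<bar>m n\<bar> \<le> R * exp (M * R)" for n
  proof -
    have "\<bar>exp (- lam n * A) - exp (- \<mu> * A)\<bar> \<le> exp (M * R) * \<bar>- lam n * A - - \<mu> * A\<bar>"
      by (intro exp_diff_le le_MR lam \<mu>)
    also have "\<bar>- lam n * A - - \<mu> * A\<bar> = \<bar>lam n - \<mu>\<bar> * A"
      using A by (simp add: abs_mult[symmetric] left_diff_distrib[symmetric] abs_minus_commute abs_mult)
    also have "exp (M * R) * (\<bar>lam n - \<mu>\<bar> * A) \<le> exp (M * R) * (\<bar>lam n - \<mu>\<bar> * R)"
      using A by (intro mult_left_mono) auto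
    finally have "\<bar>exp (- lam n * A) - exp (- \<mu> * A)\<bar> \<le> R * exp (M * R) * \<bar>lam n - \<mu>\<bar>"
      by (simp add: mult_ac)
    then show ?thesis
      using A by (cases "lam n = \<mu>") (simp_all add: m_def divide_le_eq)
  qed
  have "(exp (- lam n * A) - exp (- \<mu> * A)) * (x \<bullet> e n) = m n * (g \<bullet> e n)" for n
    unfolding defect[symmetric] by (cases "lam n = \<mu>") (simp_all add: m_def)
  then have "evolve lam A N x - exp (- \<mu> * A) *\<^sub>R proj N x = (\<Sum>n<N. (m n * (g \<bullet> e n)) *\<^sub>R e n)"
    unfolding evolve_def proj_def scaleR_sum_right sum_subtractf[symmetric] scaleR_scaleR
      scaleR_diff_left[symmetric] left_diff_distrib[symmetric] by simp
  also have "norm \<dots> \<le> R * exp (M * R) * norm g"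
    by (rule norm_multiplier_le[OF m_le]) (use A in auto)
  finally show ?thesis .
qed

end

lemma eig_solution_evolve:
  assumes q: "sturm_liouville q M" and spec: "dir_spectrum q lam \<phi>" and u0: "L2 u0" and v: "L2 v"
    and lim: "(\<lambda>N. L2norm (\<lambda>x. v x - (\<Sum>n<N. integral {0..1} (\<lambda>y. u0 y * \<phi> n y)
               * exp (- lam n * A) * \<phi> n x))) \<longlonglongrightarrow> 0"
  shows "(\<lambda>N. orthonormal.evolve (\<lambda>n. abs_l2 (\<phi> n)) lam A N (abs_l2 u0)) \<longlonglongrightarrow> abs_l2 v"
proof -
  interpret orthonormal "\<lambda>n. abs_l2 (\<phi> n)"
    by (rule sturm_liouville.eigenfunctions_orthonormal[OF q spec])
  have \<phi>L2: "L2 (\<phi> n)" for n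
    using spec dir_eigenpair_L2 unfolding dir_spectrum_def by blast
  define s where "s N x = (\<Sum>n<N. integral {0..1} (\<lambda>y. u0 y * \<phi> n y) * exp (- lam n * A) * \<phi> n x)" for N x
  have sL2: "L2 (s N)" for N
    unfolding s_def by (intro L2_sum L2_cmult \<phi>L2)
  have "evolve lam A N (abs_l2 u0) = abs_l2 (s N)" for N
    unfolding evolve_def s_def inner_abs_l2[OF u0 \<phi>L2] abs_l2_scaleR[OF \<phi>L2]
    by (subst abs_l2_sum) (rule L2_cmult[OF \<phi>L2], simp add: mult_ac)
  moreover have "(\<lambda>N. abs_l2 v - abs_l2 (s N)) \<longlonglongrightarrow> 0"
  proof (rule tendsto_norm_zero_cancel)
    show "(\<lambda>N. norm (abs_l2 v - abs_l2 (s N))) \<longlonglongrightarrow> 0"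
      using lim unfolding abs_l2_diff[OF v sL2] norm_abs_l2[OF L2_diff[OF v sL2]] unfolding s_def .
  qed
  from tendsto_diff[OF tendsto_const[of "abs_l2 v"] this] have "(\<lambda>N. abs_l2 (s N)) \<longlonglongrightarrow> abs_l2 v"
    by simp
  ultimately show ?thesis
    by simp
qed

text \<open>The cutoff \<open>N\<close> is free, and no quantity of the primed spectrum survives on
  the right, which makes the bound usable uniformly in the perturbation. The residual of
  \<open>U0\<close> counts twice: once for cutting off the series of \<open>U\<close>, once for
  comparing \<open>v\<close> with \<open>U0\<close> under the primed evolution.\<close>

theorem solution_stability:
  assumes q: "sturm_liouville q M" and q': "sturm_liouville q' M"
    and \<delta>: "0 \<le> \<delta>" "\<And>x. x \<in> {0..1} \<Longrightarrow> \<bar>q' x - q x\<bar> \<le> \<delta>"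
    and spec: "dir_spectrum q lam \<phi>" and spec': "dir_spectrum q' lam' \<phi>'"
    and A: "0 \<le> A" "A \<le> R" and A': "0 \<le> A'" "A' \<le> R"
    and U: "(\<lambda>N. orthonormal.evolve (\<lambda>n. abs_l2 (\<phi> n)) lam A N U0) \<longlonglongrightarrow> U"
    and U': "(\<lambda>N. orthonormal.evolve (\<lambda>n. abs_l2 (\<phi>' n)) lam' A' N U0') \<longlonglongrightarrow> U'"
  shows "norm (U - U') \<le> 2 * exp (M * R) * norm (U0 - orthonormal.proj (\<lambda>n. abs_l2 (\<phi> n)) N U0)
    + (\<Sum>n<N. \<bar>U0 \<bullet> abs_l2 (\<phi> n)\<bar> * (\<bar>exp (- lam n * A) - exp (- lam n * A')\<bar> + R * exp (M * R) * \<delta>))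
    + exp (M * R) * norm (U0 - U0')"
proof -
  interpret q: sturm_liouville q M by fact
  interpret q': sturm_liouville q' M by fact
  define e where "e n = abs_l2 (\<phi> n)" for n
  define e' where "e' n = abs_l2 (\<phi>' n)" for n
  interpret e: orthonormal e
    unfolding e_def by (rule q.eigenfunctions_orthonormal[OF spec])
  interpret e': orthonormal e'
    unfolding e'_def by (rule q'.eigenfunctions_orthonormal[OF spec'])
  have eig: "dir_eigenpair q (lam n) (\<phi> n)" "dir_eigenpair q' (lam' n) (\<phi>' n)" for n
    using spec spec' unfolding dir_spectrum_def by auto
  have lam: "- M \<le> lam n" "- M \<le> lam' n" for n
    using q.eigenvalue_ge[OF eig(1)] q'.eigenvalue_ge[OF eig(2)] .
  note M = q.bound_nonneg
  define E where "E = exp (M * R)"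
  define B where "B n = U0 \<bullet> e n" for n
  define v where "v = e.proj N U0"
  define S where "S J x = e'.evolve lam' A' J x" for J x
  have U'_lim: "(\<lambda>J. S J U0') \<longlonglongrightarrow> U'"
    using U' unfolding S_def e'_def .
  have S_le: "norm (S J x) \<le> E * norm x" for J x
    unfolding S_def E_def by (rule e'.norm_evolve_le[OF lam(2) M A'])
  have t1: "norm (U - e.evolve lam A N U0) \<le> E * norm (U0 - v)"
    unfolding E_def v_def using U unfolding e_def[symmetric] by (rule e.norm_evolve_tail_le[OF lam(1) M A])
  have norm_e: "norm (e n) = 1" for n
    using e.orthonormal[of n n] by (simp add: norm_eq_sqrt_inner)
  have t2: "norm (e.evolve lam A N U0 - (\<Sum>n<N. B n *\<^sub>R (exp (- lam n * A') *\<^sub>R e n)))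
      \<le> (\<Sum>n<N. \<bar>B n\<bar> * \<bar>exp (- lam n * A) - exp (- lam n * A')\<bar>)"
  proof -
    have "e.evolve lam A N U0 - (\<Sum>n<N. B n *\<^sub>R (exp (- lam n * A') *\<^sub>R e n))
        = (\<Sum>n<N. (B n * (exp (- lam n * A) - exp (- lam n * A'))) *\<^sub>R e n)"
      unfolding e.evolve_def B_def by (simp add: sum_subtractf[symmetric] algebra_simps)
    also have "norm \<dots> \<le> (\<Sum>n<N. norm ((B n * (exp (- lam n * A) - exp (- lam n * A'))) *\<^sub>R e n))"
      by (rule norm_sum)
    finally show ?thesis
      by (simp add: norm_e abs_mult)
  qed
  \<comment> \<open>\<open>e n\<close> is an approximate eigenvector of the primed operator, with
    defect given by the difference of the potentials. The multiplier estimate compares with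
    \<open>e'.proj J (e n)\<close> only, so the residual of \<open>e n\<close> in the primed system
    remains as an extra term.\<close>
  have t3: "norm (exp (- lam n * A') *\<^sub>R e n - S J (e n))
      \<le> R * E * \<delta> + exp (- lam n * A') * norm (e n - e'.proj J (e n))" for n J
  proof -
    define g where "g = abs_l2 (\<lambda>x. (q' x - q x) * \<phi> n x)"
    have "norm (S J (e n) - exp (- lam n * A') *\<^sub>R e'.proj J (e n)) \<le> R * exp (M * R) * norm g"
      unfolding S_def
    proof (rule e'.norm_evolve_approximate_eigenvector[OF lam(2) lam(1) M A'])
      show "(lam' k - lam n) * (e n \<bullet> e' k) = g \<bullet> e' k" for k
        unfolding e_def e'_def g_def
        by (rule eigenpair_inner[OF q.bounded_measurable_axioms q'.bounded_measurable_axioms eig(1) eig(2)])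
    qed
    moreover have "norm g \<le> \<delta>"
    proof -
      note \<phi>L2 = dir_eigenpair_L2[OF eig(1)]
      have "norm g \<le> \<delta> * norm (abs_l2 (\<phi> n))"
        unfolding g_def
      proof (rule norm_abs_l2_mult_le[OF \<phi>L2 _ \<delta>])
        show "L2 (\<lambda>x. (q' x - q x) * \<phi> n x)"
          unfolding left_diff_distrib by (intro L2_diff q.L2_mult q'.L2_mult \<phi>L2)
      qed
      then show ?thesis
        using norm_e[of n] by (simp add: e_def)
    qed
    then have "R * exp (M * R) * norm g \<le> R * E * \<delta>"
      unfolding E_def using A by (intro mult_left_mono) auto
    ultimately have 1: "norm (exp (- lam n * A') *\<^sub>R e'.proj J (e n) - S J (e n)) \<le> R * E * \<delta>"
      by (subst norm_minus_commute) linarith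
    have "exp (- lam n * A') *\<^sub>R e n - S J (e n) = (exp (- lam n * A') *\<^sub>R e'.proj J (e n) - S J (e n))
        + exp (- lam n * A') *\<^sub>R (e n - e'.proj J (e n))"
      by (simp add: algebra_simps)
    also have "norm \<dots> \<le> R * E * \<delta> + norm (exp (- lam n * A') *\<^sub>R (e n - e'.proj J (e n)))"
      using 1 by (intro order_trans[OF norm_triangle_ineq] add_right_mono)
    finally show ?thesis
      by simp
  qed
  have Sv: "S J v = (\<Sum>n<N. B n *\<^sub>R S J (e n))" for J
    unfolding S_def v_def e.proj_def B_def by (rule e'.evolve_sum_scaleR)
  have t3': "norm ((\<Sum>n<N. B n *\<^sub>R (exp (- lam n * A') *\<^sub>R e n)) - S J v)
      \<le> (\<Sum>n<N. \<bar>B n\<bar> * (R * E * \<delta> + exp (- lam n * A') * norm (e n - e'.proj J (e n))))" for J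
  proof -
    have "(\<Sum>n<N. B n *\<^sub>R (exp (- lam n * A') *\<^sub>R e n)) - S J v
        = (\<Sum>n<N. B n *\<^sub>R (exp (- lam n * A') *\<^sub>R e n - S J (e n)))"
      by (simp add: Sv sum_subtractf[symmetric] scaleR_diff_right)
    also have "norm \<dots> \<le> (\<Sum>n<N. norm (B n *\<^sub>R (exp (- lam n * A') *\<^sub>R e n - S J (e n))))"
      by (rule norm_sum)
    also have "\<dots> \<le> (\<Sum>n<N. \<bar>B n\<bar> * (R * E * \<delta> + exp (- lam n * A') * norm (e n - e'.proj J (e n))))"
      unfolding norm_scaleR by (intro sum_mono mult_left_mono t3) auto
    finally show ?thesis .
  qed
  \<comment> \<open>Everything is estimated at a finite cutoff \<open>J\<close> of the primed
    series; the terms depending on \<open>J\<close> disappear in the limit.\<close>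
  define rhs where "rhs J = E * norm (U0 - v) + (\<Sum>n<N. \<bar>B n\<bar> * \<bar>exp (- lam n * A) - exp (- lam n * A')\<bar>)
    + (\<Sum>n<N. \<bar>B n\<bar> * (R * E * \<delta> + exp (- lam n * A') * norm (e n - e'.proj J (e n))))
    + E * norm (v - U0) + E * norm (U0 - U0') + norm (S J U0' - U')" for J
  have "norm (U - U') \<le> rhs J" for J
  proof -
    define W where "W = (\<Sum>n<N. B n *\<^sub>R (exp (- lam n * A') *\<^sub>R e n))"
    have "U - U' = (U - e.evolve lam A N U0) + (e.evolve lam A N U0 - W) + (W - S J v) + S J (v - U0)
        + S J (U0 - U0') + (S J U0' - U')"
      by (simp add: S_def e'.evolve_diff)
    also have "norm \<dots> \<le> norm (U - e.evolve lam A N U0) + norm (e.evolve lam A N U0 - W) + norm (W - S J v)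
        + norm (S J (v - U0)) + norm (S J (U0 - U0')) + norm (S J U0' - U')"
      by (intro order_trans[OF norm_triangle_ineq] add_right_mono order_refl)
    also have "\<dots> \<le> rhs J"
      unfolding rhs_def W_def by (intro add_mono t1 t2 t3' S_le order_refl)
    finally show ?thesis .
  qed
  moreover have "rhs \<longlonglongrightarrow> E * norm (U0 - v) + (\<Sum>n<N. \<bar>B n\<bar> * \<bar>exp (- lam n * A) - exp (- lam n * A')\<bar>)
    + (\<Sum>n<N. \<bar>B n\<bar> * (R * E * \<delta> + exp (- lam n * A') * norm (e n - e n)))
    + E * norm (v - U0) + E * norm (U0 - U0') + norm (U' - U')"
    unfolding rhs_def
  \<comment> \<open>Completeness of the primed system is needed only for the
    \<open>\<phi> n\<close>; these satisfy the Dirichlet conditions and have square-integrable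
    second derivative, so their primed expansions converge.\<close>
  proof (intro tendsto_intros U'_lim)
    fix n
    obtain \<psi> where \<psi>: "\<phi> n 0 = 0" "\<phi> n 1 = 0" "second_deriv (\<phi> n) \<psi> (\<lambda>s. (q s - lam n) * \<phi> n s)"
      using eig(1)[of n] unfolding dir_eigenpair_iff by blast
    show "(\<lambda>J. e'.proj J (e n)) \<longlonglongrightarrow> e n"
      using q'.eigenfunction_expansion[OF spec' \<psi>(3) q.L2_eigen_rhs[OF dir_eigenpair_continuous[OF eig(1)]] \<psi>(1,2)]
      unfolding e_def e'_def .
  qed
  ultimately have "norm (U - U') \<le> E * norm (U0 - v) + (\<Sum>n<N. \<bar>B n\<bar> * \<bar>exp (- lam n * A) - exp (- lam n * A')\<bar>)
    + (\<Sum>n<N. \<bar>B n\<bar> * (R * E * \<delta> + exp (- lam n * A') * norm (e n - e n)))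
    + E * norm (v - U0) + E * norm (U0 - U0') + norm (U' - U')"
    by (intro LIMSEQ_le_const) auto
  also have "\<dots> = 2 * E * norm (U0 - v)
      + (\<Sum>n<N. \<bar>B n\<bar> * (\<bar>exp (- lam n * A) - exp (- lam n * A')\<bar> + R * E * \<delta>)) + E * norm (U0 - U0')"
    by (simp add: norm_minus_commute sum.distrib distrib_left)
  finally show ?thesis
    unfolding E_def v_def B_def e_def .
qed

section \<open>Choice of the constants and uniformity in time\<close>

theorem theorem5:
  fixes T a0 :: real and q a u0 :: "real \<Rightarrow> real" and u :: "real \<Rightarrow> real \<Rightarrow> real"
    and q\<epsilon> a\<epsilon> u0\<epsilon> :: "real \<Rightarrow> real \<Rightarrow> real" and u\<epsilon> :: "real \<Rightarrow> real \<Rightarrow> real \<Rightarrow> real"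
  assumes "T > 0"
    and "Linf {0..1} q"
    and "Linf {0..T} a" and "a0 > 0" and "\<forall>t\<in>{0..T}. a t \<ge> a0"
    and "H2 u0"
    and "eig_solution T q a u0 u"
    and "\<forall>\<epsilon>. Linf {0..1} (q\<epsilon> \<epsilon>) \<and> Linf {0..T} (a\<epsilon> \<epsilon>) \<and> L2 (u0\<epsilon> \<epsilon>)"
    and "((\<lambda>\<epsilon>. L2norm (\<lambda>x. u0 x - u0\<epsilon> \<epsilon> x)) \<longlongrightarrow> 0) (at_right 0)"
    and "((\<lambda>\<epsilon>. Linf_norm {0..1} (\<lambda>x. q x - q\<epsilon> \<epsilon> x)) \<longlongrightarrow> 0) (at_right 0)"
    and "((\<lambda>\<epsilon>. Linf_norm {0..T} (\<lambda>t. a t - a\<epsilon> \<epsilon> t)) \<longlongrightarrow> 0) (at_right 0)"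
    and "\<forall>\<epsilon>>0. eig_solution T (q\<epsilon> \<epsilon>) (a\<epsilon> \<epsilon>) (u0\<epsilon> \<epsilon>) (u\<epsilon> \<epsilon>)"
  shows "((\<lambda>\<epsilon>. SUP t\<in>{0..T}. L2norm (\<lambda>x. u t x - u\<epsilon> \<epsilon> t x)) \<longlongrightarrow> 0) (at_right 0)"
proof (rule tendstoI)
  fix e :: real assume "e > 0"
  obtain lam \<phi> where spec: "dir_spectrum q lam \<phi>"
    and sol: "\<And>t. t \<in> {0..T} \<Longrightarrow> L2 (u t) \<and> (\<lambda>N. L2norm (\<lambda>x. u t x - (\<Sum>n<N. integral {0..1} (\<lambda>y. u0 y * \<phi> n y)
               * exp (- lam n * integral {0..t} a) * \<phi> n x))) \<longlonglongrightarrow> 0"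
    using assms(7) unfolding eig_solution_def by blast
  have u0: "L2 u0"
    using assms(6) unfolding H2_def by blast
  obtain M where M: "0 \<le> M" "q \<in> borel_measurable (lebesgue_on {0..1})" "AE x in lebesgue_on {0..1}. \<bar>q x\<bar> \<le> M"
    using LinfE[OF assms(2)] .
  define qb where "qb = truncate (\<lambda>_. 0) M q"
  have qb_meas: "qb \<in> borel_measurable (lebesgue_on {0..1})"
    unfolding qb_def by (intro truncate_measurable borel_measurable_const M)
  have qb_bound: "\<bar>qb x\<bar> \<le> M" for x
    using truncate_bound[OF M(1), of "\<lambda>_. 0" q x] by (simp add: qb_def)
  have q_qb: "AE x in lebesgue_on {0..1}. q x = qb x"
    unfolding qb_def by (rule truncate_AE) (use M(3) in simp)
  note spec_b = dir_spectrum_cong_AE[OF q_qb spec]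
  \<comment> \<open>The extra 1 leaves room for the perturbed potential, which will be within
    \<open>\<delta> \<le> 1\<close> of \<open>qb\<close>; both spectra are then bounded below by the
    same constant.\<close>
  have sl: "sturm_liouville qb (M + 1)"
    by unfold_locales (use qb_meas qb_bound in \<open>auto intro: add_increasing2\<close>)
  obtain Ca where Ca: "0 \<le> Ca" "a \<in> borel_measurable (lebesgue_on {0..T})" "AE x in lebesgue_on {0..T}. \<bar>a x\<bar> \<le> Ca"
    using LinfE[OF assms(3)] .
  \<comment> \<open>Common bound for both time integrals: the unperturbed one is at most
    \<open>Ca * t\<close>, and the perturbed one exceeds it by at most
    \<open>\<eta> * t \<le> a0 * t\<close>.\<close>
  define R where "R = (Ca + a0) * T"
  define E where "E = exp ((M + 1) * R)"
  have "R \<ge> 0" "E > 0"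
    using Ca(1) assms(1,4) by (auto simp: R_def E_def)
  define U0 where "U0 = abs_l2 u0"
  define B where "B n = U0 \<bullet> abs_l2 (\<phi> n)" for n
  interpret orthonormal "\<lambda>n. abs_l2 (\<phi> n)"
    by (rule sturm_liouville.eigenfunctions_orthonormal[OF sl spec_b])
  have "(\<lambda>N. proj N U0) \<longlonglongrightarrow> U0"
    unfolding U0_def by (rule sturm_liouville.eigenfunction_expansion_H2[OF sl spec_b assms(6)])
  then obtain N where "norm (proj N U0 - U0) < e / (16 * E)"
    using LIMSEQ_D[of _ U0 "e / (16 * E)"] \<open>e > 0\<close> \<open>E > 0\<close> by auto
  then have N: "2 * E * norm (U0 - proj N U0) \<le> e / 8"
    using \<open>E > 0\<close> by (simp add: norm_minus_commute field_simps)
  \<comment> \<open>\<open>W\<close> and \<open>Z\<close> are the factors of \<eta> and \<delta> in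
    the finite sum of \<open>solution_stability\<close>; once \<open>N\<close> is fixed they depend
    neither on \<epsilon> nor on \<open>t\<close>.\<close>
  define W where "W = (\<Sum>n<N. \<bar>B n\<bar> * (exp (\<bar>lam n\<bar> * R) * \<bar>lam n\<bar> * T))"
  define Z where "Z = (\<Sum>n<N. \<bar>B n\<bar> * (R * E))"
  have "W \<ge> 0" "Z \<ge> 0"
    using \<open>T > 0\<close> \<open>R \<ge> 0\<close> \<open>E > 0\<close> unfolding W_def Z_def by (auto intro!: sum_nonneg mult_nonneg_nonneg)
  \<comment> \<open>\<open>\<delta> \<le> 1\<close> secures the common bound of the potentials. The
    perturbed coefficient comes with no lower bound of its own, and \<open>\<eta> \<le> a0\<close>
    is what keeps its time integral nonnegative. The denominators \<open>Z + 1\<close> and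
    \<open>W + 1\<close> cover vanishing sums.\<close>
  define \<delta> where "\<delta> = min 1 (e / (8 * (Z + 1)))"
  define \<eta> where "\<eta> = min a0 (e / (8 * (W + 1)))"
  define \<rho> where "\<rho> = e / (8 * E)"
  have pos: "\<delta> > 0" "\<eta> > 0" "\<rho> > 0"
    using \<open>e > 0\<close> \<open>W \<ge> 0\<close> \<open>Z \<ge> 0\<close> \<open>E > 0\<close> assms(4) by (auto simp: \<delta>_def \<eta>_def \<rho>_def)
  have small: "x * min b (e / (8 * (x + 1))) \<le> e / 8" if "x \<ge> 0" for x b :: real
  proof -
    have "x * min b (e / (8 * (x + 1))) \<le> x * (e / (8 * (x + 1)))"
      using that by (intro mult_left_mono) auto
    also have "\<dots> \<le> e / 8"
      using that \<open>e > 0\<close> by (simp add: field_simps)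
    finally show ?thesis .
  qed
  have "\<forall>\<^sub>F \<epsilon> in at_right 0. L2norm (\<lambda>x. u0 x - u0\<epsilon> \<epsilon> x) < \<rho>"
    by (rule order_tendstoD(2)[OF assms(9) pos(3)])
  moreover have "\<forall>\<^sub>F \<epsilon> in at_right 0. Linf_norm {0..1} (\<lambda>x. q x - q\<epsilon> \<epsilon> x) < ereal \<delta>"
    by (rule order_tendstoD(2)[OF assms(10)]) (use pos in simp)
  moreover have "\<forall>\<^sub>F \<epsilon> in at_right 0. Linf_norm {0..T} (\<lambda>t. a t - a\<epsilon> \<epsilon> t) < ereal \<eta>"
    by (rule order_tendstoD(2)[OF assms(11)]) (use pos in simp)
  moreover have "\<forall>\<^sub>F \<epsilon> in at_right 0. 0 < (\<epsilon>::real)"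
    by (rule eventually_at_right_less)
  ultimately show "\<forall>\<^sub>F \<epsilon> in at_right 0. dist (SUP t\<in>{0..T}. L2norm (\<lambda>x. u t x - u\<epsilon> \<epsilon> t x)) 0 < e"
  proof eventually_elim
    case (elim \<epsilon>)
    have reg: "Linf {0..1} (q\<epsilon> \<epsilon>)" "Linf {0..T} (a\<epsilon> \<epsilon>)" "L2 (u0\<epsilon> \<epsilon>)"
      using assms(8) by auto
    obtain lam' \<phi>' where spec': "dir_spectrum (q\<epsilon> \<epsilon>) lam' \<phi>'"
      and sol': "\<And>t. t \<in> {0..T} \<Longrightarrow> L2 (u\<epsilon> \<epsilon> t) \<and> (\<lambda>N. L2norm (\<lambda>x. u\<epsilon> \<epsilon> t x - (\<Sum>n<N. integral {0..1} (\<lambda>y. u0\<epsilon> \<epsilon> y * \<phi>' n y)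
               * exp (- lam' n * integral {0..t} (a\<epsilon> \<epsilon>)) * \<phi>' n x))) \<longlonglongrightarrow> 0"
      using assms(12) \<open>0 < \<epsilon>\<close> unfolding eig_solution_def by blast
    \<comment> \<open>Clamping around \<open>qb\<close> rather than around 0 gives a distance of at
      most \<delta> and the bound \<open>M + 1\<close> at every point at once.\<close>
    define qe where "qe = truncate qb \<delta> (q\<epsilon> \<epsilon>)"
    have qe_bound: "\<bar>qe x - qb x\<bar> \<le> \<delta>" for x
      using truncate_bound[of \<delta> qb "q\<epsilon> \<epsilon>" x] pos by (simp add: qe_def)
    have "AE x in lebesgue_on {0..1}. \<bar>q\<epsilon> \<epsilon> x - qb x\<bar> \<le> \<delta>"
      using AE_bound_of_Linf_norm_less[OF elim(2)] q_qb by eventually_elim (simp add: abs_minus_commute)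
    then have "AE x in lebesgue_on {0..1}. q\<epsilon> \<epsilon> x = qe x"
      unfolding qe_def by (rule truncate_AE)
    note spec_e = dir_spectrum_cong_AE[OF this spec']
    have "\<delta> \<le> 1"
      by (simp add: \<delta>_def)
    have sl': "sturm_liouville qe (M + 1)"
    proof unfold_locales
      show "qe \<in> borel_measurable (lebesgue_on {0..1})"
        unfolding qe_def using reg(1) by (intro truncate_measurable qb_meas) (simp add: Linf_def)
      show "\<bar>qe x\<bar> \<le> M + 1" for x
        using qe_bound[of x] qb_bound[of x] \<open>\<delta> \<le> 1\<close> by linarith
    qed
    have U0_diff: "norm (U0 - abs_l2 (u0\<epsilon> \<epsilon>)) \<le> \<rho>"
      using elim(1) unfolding U0_def by (simp add: abs_l2_diff[OF u0 reg(3)] norm_abs_l2[OF L2_diff[OF u0 reg(3)]])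
    have le: "L2norm (\<lambda>x. u t x - u\<epsilon> \<epsilon> t x) \<le> e / 2" if t: "t \<in> {0..T}" for t
    proof -
      define A where "A = integral {0..t} a"
      define A' where "A' = integral {0..t} (a\<epsilon> \<epsilon>)"
      note ai = Linf_integrable[OF assms(3) t] and ai' = Linf_integrable[OF reg(2) t]
      have A_ge: "a0 * t \<le> A"
        using integral_le[OF integrable_const_ivl[of a0 0 t] ai] assms(5) t by (simp add: A_def mult.commute)
      have A_le: "A \<le> Ca * t"
        using abs_integral_le_AE[OF Ca t] by (simp add: A_def)
      have A_diff: "\<bar>A - A'\<bar> \<le> \<eta> * t"
      proof -
        have "\<bar>integral {0..t} (\<lambda>s. a s - a\<epsilon> \<epsilon> s)\<bar> \<le> \<eta> * t"
          using pos Ca(2) reg(2)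
          by (intro abs_integral_le_AE[OF _ _ AE_bound_of_Linf_norm_less[OF elim(3)] t]) (auto simp: Linf_def)
        then show ?thesis
          by (simp add: A_def A'_def Henstock_Kurzweil_Integration.integral_diff[OF ai ai'])
      qed
      have "\<eta> * t \<le> a0 * t"
        using t by (intro mult_right_mono) (auto simp: \<eta>_def)
      moreover have "0 \<le> a0 * t"
        using t assms(4) by simp
      moreover have "(Ca + a0) * t \<le> R"
        unfolding R_def using t Ca(1) assms(4) by (intro mult_left_mono) auto
      then have "Ca * t + a0 * t \<le> R"
        by (simp add: algebra_simps)
      ultimately have AR: "0 \<le> A" "A \<le> R" "0 \<le> A'" "A' \<le> R"
        using A_ge A_le A_diff by linarith+
      have "\<bar>A - A'\<bar> \<le> \<eta> * T"
        using A_diff t pos by (intro order_trans[OF A_diff] mult_left_mono) auto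
      have exp_le: "\<bar>exp (- lam n * A) - exp (- lam n * A')\<bar> \<le> exp (\<bar>lam n\<bar> * R) * \<bar>lam n\<bar> * T * \<eta>" for n
      proof -
        have "- lam n * s \<le> \<bar>lam n\<bar> * R" if "0 \<le> s" "s \<le> R" for s
          using that by (intro mult_mono) auto
        then have "\<bar>exp (- lam n * A) - exp (- lam n * A')\<bar> \<le> exp (\<bar>lam n\<bar> * R) * \<bar>- lam n * A - - lam n * A'\<bar>"
          using AR by (intro exp_diff_le) auto
        also have "\<bar>- lam n * A - - lam n * A'\<bar> = \<bar>lam n\<bar> * \<bar>A - A'\<bar>"
          by (simp add: abs_mult[symmetric] right_diff_distrib abs_minus_commute)
        also have "exp (\<bar>lam n\<bar> * R) * (\<bar>lam n\<bar> * \<bar>A - A'\<bar>) \<le> exp (\<bar>lam n\<bar> * R) * (\<bar>lam n\<bar> * (\<eta> * T))"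
          using \<open>\<bar>A - A'\<bar> \<le> \<eta> * T\<close> by (intro mult_left_mono) auto
        finally show ?thesis
          by (simp add: mult_ac)
      qed
      have "norm (abs_l2 (u t) - abs_l2 (u\<epsilon> \<epsilon> t)) \<le> 2 * E * norm (U0 - proj N U0)
          + (\<Sum>n<N. \<bar>B n\<bar> * (\<bar>exp (- lam n * A) - exp (- lam n * A')\<bar> + R * E * \<delta>))
          + E * norm (U0 - abs_l2 (u0\<epsilon> \<epsilon>))"
        unfolding E_def B_def
      proof (rule solution_stability[OF sl sl' _ qe_bound spec_b spec_e AR])
        show "(\<lambda>N. evolve lam A N U0) \<longlonglongrightarrow> abs_l2 (u t)"
          unfolding U0_def A_def using sol[OF t] by (intro eig_solution_evolve[OF sl spec_b u0]) auto
        show "(\<lambda>N. orthonormal.evolve (\<lambda>n. abs_l2 (\<phi>' n)) lam' A' N (abs_l2 (u0\<epsilon> \<epsilon>))) \<longlonglongrightarrow> abs_l2 (u\<epsilon> \<epsilon> t)"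
          unfolding A'_def using sol'[OF t] by (intro eig_solution_evolve[OF sl' spec_e reg(3)]) auto
      qed (use pos in simp)
      also have "\<dots> \<le> e / 8 + (W * \<eta> + Z * \<delta>) + e / 8"
      proof (intro add_mono N)
        have "(\<Sum>n<N. \<bar>B n\<bar> * (\<bar>exp (- lam n * A) - exp (- lam n * A')\<bar> + R * E * \<delta>))
            \<le> (\<Sum>n<N. \<bar>B n\<bar> * (exp (\<bar>lam n\<bar> * R) * \<bar>lam n\<bar> * T * \<eta> + R * E * \<delta>))"
          by (intro sum_mono mult_left_mono add_right_mono exp_le) auto
        also have "\<dots> = W * \<eta> + Z * \<delta>"
          unfolding W_def Z_def sum_distrib_right sum.distrib[symmetric]
          by (intro sum.cong refl) (simp add: algebra_simps)
        finally show "(\<Sum>n<N. \<bar>B n\<bar> * (\<bar>exp (- lam n * A) - exp (- lam n * A')\<bar> + R * E * \<delta>)) \<le> W * \<eta> + Z * \<delta>" .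
        have "E * norm (U0 - abs_l2 (u0\<epsilon> \<epsilon>)) \<le> E * \<rho>"
          using U0_diff \<open>E > 0\<close> by (intro mult_left_mono) auto
        then show "E * norm (U0 - abs_l2 (u0\<epsilon> \<epsilon>)) \<le> e / 8"
          using \<open>E > 0\<close> by (simp add: \<rho>_def)
      qed
      \<comment> \<open>Four contributions of \<open>e / 8\<close>: cutoff of the initial value,
        time coefficient, potential, and perturbation of the initial value. Stopping at
        \<open>e / 2\<close> keeps the inequality strict after the supremum.\<close>
      also have "\<dots> \<le> e / 2"
        using small[OF \<open>W \<ge> 0\<close>, of a0] small[OF \<open>Z \<ge> 0\<close>, of 1] unfolding \<eta>_def \<delta>_def by linarith
      finally show ?thesis
        using sol[OF t] sol'[OF t] by (simp add: abs_l2_diff norm_abs_l2 L2_diff)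
    qed
    have "(SUP t\<in>{0..T}. L2norm (\<lambda>x. u t x - u\<epsilon> \<epsilon> t x)) \<le> e / 2"
      using \<open>T > 0\<close> by (intro cSUP_least le) auto
    \<comment> \<open>A real supremum bounds its members only when the set is bounded above; this is
      supplied by \<open>le\<close>, and the member at time 0 is nonnegative.\<close>
    moreover have "0 \<le> (SUP t\<in>{0..T}. L2norm (\<lambda>x. u t x - u\<epsilon> \<epsilon> t x))"
    proof (rule cSUP_upper2)
      show "bdd_above ((\<lambda>t. L2norm (\<lambda>x. u t x - u\<epsilon> \<epsilon> t x)) ` {0..T})"
        using le by (intro bdd_aboveI2[of _ _ "e / 2"])
      show "0 \<in> {0..T}"
        using \<open>T > 0\<close> by simp
      have "L2 (\<lambda>x. u 0 x - u\<epsilon> \<epsilon> 0 x)"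
        using sol[of 0] sol'[of 0] \<open>T > 0\<close> by (intro L2_diff) auto
      then show "0 \<le> L2norm (\<lambda>x. u 0 x - u\<epsilon> \<epsilon> 0 x)"
        using norm_ge_zero norm_abs_l2 by metis
    qed
    ultimately show ?case
      using \<open>e > 0\<close> by simp
  qed
qed

end
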